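(* Let $(\{A_n\}_{n},\{\Psi_n\}_{n})$ be an operator-valued p-ASF in $\mathcal{B}(\mathcal{X},\mathcal{Y})$. Then there exist a Banach space $\mathcal{X}_1$ which contains $\mathcal{X}$ isometrically and bounded linear operators $B_n:\mathcal{X}_1\to\mathcal{Y}$, $\Phi_n:\mathcal{Y}\to\mathcal{X}_1$, for all $n\in\mathbb{N}$, such that $(\{B_n\}_{n},\{\Phi_n\}_{n})$ is an operator-valued p-ARB in $\mathcal{B}(\mathcal{X}_1,\mathcal{Y})$ and $B_n|_{\mathcal{X}}=A_n$ for all $n\in\mathbb{N}$.
   Context: Banach spaces are over $\mathbb{K}=\mathbb{R}$ or $\mathbb{C}$; $\mathcal{X},\mathcal{Y}$ are Banach spaces, $p\in[1,\infty)$, $\mathcal{B}(\mathcal{X},\mathcal{Y})$ is the space of bounded linear operators. $\ell^p(\mathbb{N})\otimes\mathcal{Y}$ is the completion of the algebraic tensor product in a fixed cross norm ($\|a\otimes y\|=\|a\|\|y\|$) for which, for all $T\in\mathcal{B}(\ell^p(\mathbb{N}))$ and $R\in\mathcal{B}(\mathcal{Y})$, $T\otimes R$ extends to a bounded operator with $\|T\otimes R\|\le\|T\|\|R\|$. With $\{e_n\}_n$ the standard Schauder basis of $\ell^p(\mathbb{N})$, $L_n:\mathcal{Y}\to\ell^p(\mathbb{N})\otimes\mathcal{Y}$ is $L_ny=e_n\otimes y$, and $\Gamma_n:\ell^p(\mathbb{N})\otimes\mathcal{Y}\to\mathcal{Y}$ is the bounded linear operator with $\Gamma_n(\{a_m\}_m\otimes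 y)=a_ny$. Thus $\Gamma_nL_n=I_{\mathcal{Y}}$, $\Gamma_nL_m=0$ for $n\ne m$, and $\sum_{n=1}^\infty L_n\Gamma_nz=z$ for all $z$. For collections $\{A_n\}_{n}$ in $\mathcal{B}(\mathcal{X},\mathcal{Y})$ and $\{\Psi_n\}_{n}$ in $\mathcal{B}(\mathcal{Y},\mathcal{X})$, the pair is an operator-valued p-approximate Schauder frame (operator-valued p-ASF) in $\mathcal{B}(\mathcal{X},\mathcal{Y})$ if: (i) the frame operator $S_{A,\Psi}x=\sum_{n=1}^\infty\Psi_nA_nx$ is a well-defined bounded linear invertible operator on $\mathcal{X}$; (ii) the analysis operator $\theta_A:\mathcal{X}\to\ell^p(\mathbb{N})\otimes\mathcal{Y}$, $\theta_Ax=\sum_{n=1}^\infty L_nA_nx$, is a well-defined bounded linear operator; (iii) the synthesis operator $\theta_\Psi:\ell^p(\mathbb{N})\otimes\mathcal{Y}\to\mathcal{X}$, $\theta_\Psi z=\sum_{n=1}^\infty\Psi_n\Gamma_nz$, is a well-defined bounded linear operator. Put $P_{A,\Psi}=\theta_AS_{A,\Psi}^{-1}\theta_\Psi$. An operator-valued p-ASF is an operator-valued p-approximate Riesz basis (operator-valued p-ARB) if $P_{A,\Psi}$ is the identity operator of $\ell^p(\mathbb{N})\otimes\mathcal{Y}$. "Contains $\mathcal{X}$ isometrically" means that $\mathcal{X}$ is identified with its image under a linear isometric embedding into $\mathcal{X}_1$. *)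

theory Defs
  imports "HOL-Analysis.Analysis" "HOL-Library.Function_Algebras"
begin

(* Banach spaces are carried by subsets of types, because the conclusion asserts the
   existence of a Banach space.  The scalars are a type of class real_normed_field; by
   Gelfand-Mazur these are, up to isometric isomorphism, exactly real and complex, and
   completeness (class banach) is then automatic. *)

record ('k, 'v) nspace =
  vecs :: "'v set"
  smul :: "'k \<Rightarrow> 'v \<Rightarrow> 'v"
  nrm :: "'v \<Rightarrow> real"

definition banach_space :: "('k::{real_normed_field,banach}, 'v::ab_group_add) nspace \<Rightarrow> bool" where
  "banach_space X \<longleftrightarrow>
     vector_space (smul X) \<and> module.subspace (smul X) (vecs X) \<and>
     (\<forall>x\<in>vecs X. 0 \<le> nrm X x) \<and>
     (\<forall>x\<in>vecs X. nrm X x = 0 \<longleftrightarrow> x = 0) \<and>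
     (\<forall>x\<in>vecs X. \<forall>y\<in>vecs X. nrm X (x + y) \<le> nrm X x + nrm X y) \<and>
     (\<forall>c. \<forall>x\<in>vecs X. nrm X (smul X c x) = norm c * nrm X x) \<and>
     (\<forall>f :: nat \<Rightarrow> 'v. range f \<subseteq> vecs X \<longrightarrow>
        (\<forall>e>0. \<exists>M. \<forall>m\<ge>M. \<forall>n\<ge>M. nrm X (f m - f n) < e) \<longrightarrow>
        (\<exists>l\<in>vecs X. (\<lambda>n. nrm X (f n - l)) \<longlonglongrightarrow> 0))"

definition sums_in :: "('k, 'v::ab_group_add) nspace \<Rightarrow> (nat \<Rightarrow> 'v) \<Rightarrow> 'v \<Rightarrow> bool" where
  "sums_in X f s \<longleftrightarrow> s \<in> vecs X \<and> (\<lambda>N. nrm X ((\<Sum>n<N. f n) - s)) \<longlonglongrightarrow> 0"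

definition linear_op ::
  "('k, 'v::ab_group_add) nspace \<Rightarrow> ('k, 'w::ab_group_add) nspace \<Rightarrow> ('v \<Rightarrow> 'w) \<Rightarrow> bool" where
  "linear_op X Y f \<longleftrightarrow>
     f \<in> vecs X \<rightarrow> vecs Y \<and>
     (\<forall>x\<in>vecs X. \<forall>x'\<in>vecs X. f (x + x') = f x + f x') \<and>
     (\<forall>c. \<forall>x\<in>vecs X. f (smul X c x) = smul Y c (f x))"

definition bounded_op ::
  "('k, 'v::ab_group_add) nspace \<Rightarrow> ('k, 'w::ab_group_add) nspace \<Rightarrow> ('v \<Rightarrow> 'w) \<Rightarrow> bool" where
  "bounded_op X Y f \<longleftrightarrow>
     linear_op X Y f \<and> (\<exists>C. \<forall>x\<in>vecs X. nrm Y (f x) \<le> C * nrm X x)"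

(* The carrier version of onorm; the vector 0 contributes 0 / 0 = 0. *)
definition op_norm :: "('k, 'v) nspace \<Rightarrow> ('k, 'w) nspace \<Rightarrow> ('v \<Rightarrow> 'w) \<Rightarrow> real" where
  "op_norm X Y f = (SUP x\<in>vecs X. nrm Y (f x) / nrm X x)"

definition invertible_op :: "('k, 'v::ab_group_add) nspace \<Rightarrow> ('v \<Rightarrow> 'v) \<Rightarrow> bool" where
  "invertible_op X f \<longleftrightarrow>
     bounded_op X X f \<and>
     (\<exists>g. bounded_op X X g \<and> (\<forall>x\<in>vecs X. g (f x) = x \<and> f (g x) = x))"

definition isometric_embedding ::
  "('k, 'v::ab_group_add) nspace \<Rightarrow> ('k, 'w::ab_group_add) nspace \<Rightarrow> ('v \<Rightarrow> 'w) \<Rightarrow> bool" where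
  "isometric_embedding X Y J \<longleftrightarrow>
     linear_op X Y J \<and> (\<forall>x\<in>vecs X. nrm Y (J x) = nrm X x)"

definition bilinear_op ::
  "('k, 'u::ab_group_add) nspace \<Rightarrow> ('k, 'v::ab_group_add) nspace \<Rightarrow> ('k, 'w::ab_group_add) nspace \<Rightarrow>
   ('u \<Rightarrow> 'v \<Rightarrow> 'w) \<Rightarrow> bool" where
  "bilinear_op U V W b \<longleftrightarrow>
     (\<forall>u\<in>vecs U. linear_op V W (b u)) \<and> (\<forall>v\<in>vecs V. linear_op U W (\<lambda>u. b u v))"

definition scalars :: "('k::real_normed_field, 'k) nspace" where
  "scalars = \<lparr>vecs = UNIV, smul = (*), nrm = norm\<rparr>"

definition lp_space :: "real \<Rightarrow> ('k::real_normed_field, nat \<Rightarrow> 'k) nspace" where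
  "lp_space p =
     \<lparr>vecs = {a. summable (\<lambda>n. norm (a n) powr p)},
      smul = (\<lambda>c a n. c * a n),
      nrm = (\<lambda>a. (\<Sum>n. norm (a n) powr p) powr (1 / p))\<rparr>"

definition unit_seq :: "nat \<Rightarrow> nat \<Rightarrow> 'k::real_normed_field" where
  "unit_seq n = (\<lambda>m. if m = n then 1 else 0)"

(* Z is a completion of the algebraic tensor product of lp_space p and Y in a cross norm
   as in the standing assumptions, with t a y the elementary tensor of a and y.
   In the algebraic tensor product a finite sum of elementary tensors is, by definition,
   zero iff every bilinear form annihilates it; the third conjunct says that Z induces no
   further (and no fewer) identifications.  Scalars are absorbed by elementary tensors, so the
   finite sums in the fourth conjunct exhaust the algebraic tensor product. *)
definition tensor_completion ::
  "real \<Rightarrow> ('k::{real_normed_field,banach}, 'y::ab_group_add) nspace \<Rightarrow>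
   ('k, 'z::ab_group_add) nspace \<Rightarrow> ((nat \<Rightarrow> 'k) \<Rightarrow> 'y \<Rightarrow> 'z) \<Rightarrow> bool" where
  "tensor_completion p Y Z t \<longleftrightarrow>
     banach_space Z \<and>
     bilinear_op (lp_space p) Y Z t \<and>
     (\<forall>m a y. (\<forall>i<m::nat. a i \<in> vecs (lp_space p) \<and> y i \<in> vecs Y) \<longrightarrow>
        ((\<Sum>i<m. t (a i) (y i)) = 0 \<longleftrightarrow>
         (\<forall>b. bilinear_op (lp_space p) Y scalars b \<longrightarrow> (\<Sum>i<m. b (a i) (y i)) = 0))) \<and>
     (\<forall>z\<in>vecs Z. \<forall>e>0. \<exists>m a y.
        (\<forall>i<m::nat. a i \<in> vecs (lp_space p) \<and> y i \<in> vecs Y) \<and>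
        nrm Z (z - (\<Sum>i<m. t (a i) (y i))) < e) \<and>
     (\<forall>a\<in>vecs (lp_space p). \<forall>y\<in>vecs Y. nrm Z (t a y) = nrm (lp_space p) a * nrm Y y) \<and>
     (\<forall>T R. bounded_op (lp_space p) (lp_space p) T \<longrightarrow> bounded_op Y Y R \<longrightarrow>
        (\<exists>U. bounded_op Z Z U \<and>
             (\<forall>a\<in>vecs (lp_space p). \<forall>y\<in>vecs Y. U (t a y) = t (T a) (R y)) \<and>
             op_norm Z Z U \<le> op_norm (lp_space p) (lp_space p) T * op_norm Y Y R))"

definition L_op :: "((nat \<Rightarrow> 'k::real_normed_field) \<Rightarrow> 'y \<Rightarrow> 'z) \<Rightarrow> nat \<Rightarrow> 'y \<Rightarrow> 'z" where
  "L_op t n y = t (unit_seq n) y"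

(* Determined on vecs Z by linearity, boundedness and density; values elsewhere are irrelevant. *)
definition Gamma_op ::
  "real \<Rightarrow> ('k::real_normed_field, 'y::ab_group_add) nspace \<Rightarrow>
   ('k, 'z::ab_group_add) nspace \<Rightarrow> ((nat \<Rightarrow> 'k) \<Rightarrow> 'y \<Rightarrow> 'z) \<Rightarrow> nat \<Rightarrow> 'z \<Rightarrow> 'y" where
  "Gamma_op p Y Z t n =
     (SOME G. bounded_op Z Y G \<and>
              (\<forall>a\<in>vecs (lp_space p). \<forall>y\<in>vecs Y. G (t a y) = smul Y (a n) y))"

definition frame_op ::
  "('k, 'x::ab_group_add) nspace \<Rightarrow> (nat \<Rightarrow> 'x \<Rightarrow> 'y) \<Rightarrow> (nat \<Rightarrow> 'y \<Rightarrow> 'x) \<Rightarrow> 'x \<Rightarrow> 'x" where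
  "frame_op X A \<Psi> x = (THE s. sums_in X (\<lambda>n. \<Psi> n (A n x)) s)"

definition analysis_op ::
  "('k::real_normed_field, 'z::ab_group_add) nspace \<Rightarrow> ((nat \<Rightarrow> 'k) \<Rightarrow> 'y \<Rightarrow> 'z) \<Rightarrow>
   (nat \<Rightarrow> 'x \<Rightarrow> 'y) \<Rightarrow> 'x \<Rightarrow> 'z" where
  "analysis_op Z t A x = (THE z. sums_in Z (\<lambda>n. L_op t n (A n x)) z)"

definition synthesis_op ::
  "real \<Rightarrow> ('k::real_normed_field, 'y::ab_group_add) nspace \<Rightarrow>
   ('k, 'z::ab_group_add) nspace \<Rightarrow> ((nat \<Rightarrow> 'k) \<Rightarrow> 'y \<Rightarrow> 'z) \<Rightarrow>
   ('k, 'x::ab_group_add) nspace \<Rightarrow> (nat \<Rightarrow> 'y \<Rightarrow> 'x) \<Rightarrow> 'z \<Rightarrow> 'x" where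
  "synthesis_op p Y Z t X \<Psi> z = (THE x. sums_in X (\<lambda>n. \<Psi> n (Gamma_op p Y Z t n z)) x)"

definition op_ASF ::
  "real \<Rightarrow> ('k::real_normed_field, 'y::ab_group_add) nspace \<Rightarrow>
   ('k, 'z::ab_group_add) nspace \<Rightarrow> ((nat \<Rightarrow> 'k) \<Rightarrow> 'y \<Rightarrow> 'z) \<Rightarrow>
   ('k, 'x::ab_group_add) nspace \<Rightarrow> (nat \<Rightarrow> 'x \<Rightarrow> 'y) \<Rightarrow> (nat \<Rightarrow> 'y \<Rightarrow> 'x) \<Rightarrow> bool" where
  "op_ASF p Y Z t X A \<Psi> \<longleftrightarrow>
     (\<forall>n. bounded_op X Y (A n)) \<and> (\<forall>n. bounded_op Y X (\<Psi> n)) \<and>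
     (\<forall>x\<in>vecs X. \<exists>s. sums_in X (\<lambda>n. \<Psi> n (A n x)) s) \<and>
     invertible_op X (frame_op X A \<Psi>) \<and>
     (\<forall>x\<in>vecs X. \<exists>z. sums_in Z (\<lambda>n. L_op t n (A n x)) z) \<and>
     bounded_op X Z (analysis_op Z t A) \<and>
     (\<forall>z\<in>vecs Z. \<exists>x. sums_in X (\<lambda>n. \<Psi> n (Gamma_op p Y Z t n z)) x) \<and>
     bounded_op Z X (synthesis_op p Y Z t X \<Psi>)"

definition P_op ::
  "real \<Rightarrow> ('k::real_normed_field, 'y::ab_group_add) nspace \<Rightarrow>
   ('k, 'z::ab_group_add) nspace \<Rightarrow> ((nat \<Rightarrow> 'k) \<Rightarrow> 'y \<Rightarrow> 'z) \<Rightarrow>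
   ('k, 'x::ab_group_add) nspace \<Rightarrow> (nat \<Rightarrow> 'x \<Rightarrow> 'y) \<Rightarrow> (nat \<Rightarrow> 'y \<Rightarrow> 'x) \<Rightarrow> 'z \<Rightarrow> 'z" where
  "P_op p Y Z t X A \<Psi> =
     analysis_op Z t A \<circ> inv_into (vecs X) (frame_op X A \<Psi>) \<circ> synthesis_op p Y Z t X \<Psi>"

definition op_ARB ::
  "real \<Rightarrow> ('k::real_normed_field, 'y::ab_group_add) nspace \<Rightarrow>
   ('k, 'z::ab_group_add) nspace \<Rightarrow> ((nat \<Rightarrow> 'k) \<Rightarrow> 'y \<Rightarrow> 'z) \<Rightarrow>
   ('k, 'x::ab_group_add) nspace \<Rightarrow> (nat \<Rightarrow> 'x \<Rightarrow> 'y) \<Rightarrow> (nat \<Rightarrow> 'y \<Rightarrow> 'x) \<Rightarrow> bool" where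
  "op_ARB p Y Z t X A \<Psi> \<longleftrightarrow>
     op_ASF p Y Z t X A \<Psi> \<and> (\<forall>z\<in>vecs Z. P_op p Y Z t X A \<Psi> z = z)"

end

theory Submission
  imports Defs
begin

text \<open>Write \<theta> for the analysis operator, \<Xi> for the synthesis operator and \<open>S = \<Xi> \<theta>\<close> for
the frame operator of the given pair. The operator \<open>P = \<theta> S\<^sup>-\<^sup>1 \<Xi>\<close> is a bounded idempotent of
\<open>Z\<close>, with \<open>P \<theta> = \<theta>\<close> and \<open>\<Xi> P = \<Xi>\<close>. So \<open>\<theta>\<close> embeds \<open>X\<close> onto the range of \<open>P\<close>, and
the kernel of \<open>P\<close> is exactly what is missing for a Riesz basis. The construction adds it: let
\<open>X1\<close> be the direct sum of \<open>X\<close> and the kernel of \<open>P\<close>, with the sum of the norms, and put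
\<open>B n (x, z) = A n x + \<Gamma> n z\<close> and \<open>\<Phi> n y = (\<Psi> n y, (I - P) (L n y))\<close>.

The reconstruction formula that \<open>z\<close> is the sum of the \<open>L n (\<Gamma> n z)\<close>
(\<open>sums_in_L_Gamma\<close>) shows that the new analysis operator is \<open>(x, z) \<mapsto> \<theta> x + z\<close> and
that the new synthesis operator is \<open>z \<mapsto> (\<Xi> z, z - P z)\<close>. Since \<open>\<Xi>\<close> vanishes on the kernel of
\<open>P\<close> and \<open>I - P\<close> vanishes on the range of \<open>\<theta>\<close>, the new frame operator is
\<open>(x, z) \<mapsto> (S x, z)\<close>, which is invertible; and the new projection maps \<open>z\<close> to
\<open>\<theta> S\<^sup>-\<^sup>1 \<Xi> z + (z - P z) = z\<close>. The computation is packaged by \<open>op_ARB_I\<close>.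

It remains to know that the bounded maps \<open>\<Gamma> n\<close> exist and that the reconstruction formula holds.
Both rest on one property of the norm of \<open>Z\<close>: restricting the sequences in \<open>\<ell>\<^sup>p\<close> to a set of
indices has norm at most one, so its tensor product with the identity is a contraction of \<open>Z\<close>
(\<open>restriction_tensor_id\<close>). For a single index \<open>n\<close> this contraction takes its values in the
isometric copy \<open>L n Y\<close> of \<open>Y\<close>, which is complete and therefore closed; undoing the isometry
gives \<open>\<Gamma> n\<close>. For the indices below \<open>N\<close> it is the \<open>N\<close>-th partial sum of the reconstruction
series, and uniformly bounded operators that converge to the identity on a dense subspace converge
to it everywhere.\<close>

section \<open>Normed spaces on carriers\<close>

lemma
  assumes "banach_space X"
  shows zero_vecs: "0 \<in> vecs X"
    and add_vecs: "\<lbrakk>x \<in> vecs X; y \<in> vecs X\<rbrakk> \<Longrightarrow> x + y \<in> vecs X"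
    and smul_vecs: "x \<in> vecs X \<Longrightarrow> smul X c x \<in> vecs X"
    and minus_vecs: "\<lbrakk>x \<in> vecs X; y \<in> vecs X\<rbrakk> \<Longrightarrow> x - y \<in> vecs X"
    and smul_one: "smul X 1 v = v"
    and smul_zero_left: "smul X 0 v = 0"
    and smul_zero_right: "smul X c 0 = 0"
    and smul_minus_one: "smul X (-1) v = - v"
    and smul_add_right: "smul X c (v + w) = smul X c v + smul X c w"
    and smul_add_left: "smul X (c + d) v = smul X c v + smul X d v"
    and smul_smul: "smul X c (smul X d v) = smul X (c * d) v"
proof -
  have V: "vector_space (smul X)" and S: "module.subspace (smul X) (vecs X)"
    using assms by (auto simp: banach_space_def)
  interpret vector_space "smul X" by (rule V)
  show "0 \<in> vecs X" by (rule subspace_0[OF S])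
  show "\<lbrakk>x \<in> vecs X; y \<in> vecs X\<rbrakk> \<Longrightarrow> x + y \<in> vecs X" by (rule subspace_add[OF S])
  show "x \<in> vecs X \<Longrightarrow> smul X c x \<in> vecs X" by (rule subspace_scale[OF S])
  show "\<lbrakk>x \<in> vecs X; y \<in> vecs X\<rbrakk> \<Longrightarrow> x - y \<in> vecs X" by (rule subspace_diff[OF S])
  show "smul X 1 v = v" "smul X 0 v = 0" "smul X c 0 = 0" "smul X (-1) v = - v"
    "smul X c (v + w) = smul X c v + smul X c w"
    "smul X (c + d) v = smul X c v + smul X d v"
    "smul X c (smul X d v) = smul X (c * d) v"
    by (simp_all add: scale_right_distrib scale_left_distrib)
qed

lemma sum_vecs:
  assumes "banach_space X" "\<And>i. i \<in> I \<Longrightarrow> f i \<in> vecs X"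
  shows "sum f I \<in> vecs X"
  using assms(2)
  by (induction I rule: infinite_finite_induct) (auto simp: assms(1) zero_vecs add_vecs)

lemma
  assumes "banach_space X"
  shows nrm_nonneg: "x \<in> vecs X \<Longrightarrow> 0 \<le> nrm X x"
    and nrm_eq_0: "x \<in> vecs X \<Longrightarrow> nrm X x = 0 \<longleftrightarrow> x = 0"
    and nrm_triangle: "\<lbrakk>x \<in> vecs X; y \<in> vecs X\<rbrakk> \<Longrightarrow> nrm X (x + y) \<le> nrm X x + nrm X y"
    and nrm_smul: "x \<in> vecs X \<Longrightarrow> nrm X (smul X c x) = norm c * nrm X x"
    and nrm_zero: "nrm X 0 = 0"
  using assms zero_vecs[OF assms] by (auto simp: banach_space_def)

lemma banach_space_complete:
  assumes "banach_space X" "\<And>n. f n \<in> vecs X"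
    "\<And>e. e > 0 \<Longrightarrow> \<exists>M. \<forall>m\<ge>M. \<forall>n\<ge>M. nrm X (f m - f n) < e"
  shows "\<exists>l\<in>vecs X. (\<lambda>n. nrm X (f n - l)) \<longlonglongrightarrow> 0"
  using assms unfolding banach_space_def by (metis image_subsetI)

lemma nrm_uminus:
  assumes "banach_space X" "x \<in> vecs X"
  shows "nrm X (- x) = nrm X x"
  using nrm_smul[OF assms, of "-1"] by (simp add: smul_minus_one[OF assms(1)])

lemma nrm_commute:
  assumes "banach_space X" "x \<in> vecs X" "y \<in> vecs X"
  shows "nrm X (x - y) = nrm X (y - x)"
  using nrm_uminus[OF assms(1) minus_vecs[OF assms]] by simp

lemma nrm_triangle_diff:
  assumes "banach_space X" "x \<in> vecs X" "y \<in> vecs X" "z \<in> vecs X"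
  shows "nrm X (x - z) \<le> nrm X (x - y) + nrm X (y - z)"
  using nrm_triangle[OF assms(1) minus_vecs[OF assms(1-3)] minus_vecs[OF assms(1) assms(3,4)]]
  by simp

lemma eq_if_nrm_arbitrarily_small:
  assumes "banach_space X" "x \<in> vecs X" "y \<in> vecs X"
    and "\<And>e. e > 0 \<Longrightarrow> nrm X (x - y) \<le> e"
  shows "x = y"
proof -
  have "nrm X (x - y) \<le> 0" using assms(4) by (rule field_le_epsilon[where y=0, simplified])
  then show ?thesis
    using nrm_nonneg[OF assms(1) minus_vecs[OF assms(1-3)]]
      nrm_eq_0[OF assms(1) minus_vecs[OF assms(1-3)]] by auto
qed

section \<open>Bounded operators\<close>

lemma bounded_opI:
  assumes "\<And>x. x \<in> vecs X \<Longrightarrow> f x \<in> vecs Y"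
    and "\<And>x y. \<lbrakk>x \<in> vecs X; y \<in> vecs X\<rbrakk> \<Longrightarrow> f (x + y) = f x + f y"
    and "\<And>c x. x \<in> vecs X \<Longrightarrow> f (smul X c x) = smul Y c (f x)"
    and "\<And>x. x \<in> vecs X \<Longrightarrow> nrm Y (f x) \<le> C * nrm X x"
  shows "bounded_op X Y f"
  using assms unfolding bounded_op_def linear_op_def by (auto intro!: exI[of _ C])

lemma
  assumes "linear_op X Y f"
  shows linear_op_vecs: "x \<in> vecs X \<Longrightarrow> f x \<in> vecs Y"
    and linear_op_add: "\<lbrakk>x \<in> vecs X; y \<in> vecs X\<rbrakk> \<Longrightarrow> f (x + y) = f x + f y"
    and linear_op_smul: "x \<in> vecs X \<Longrightarrow> f (smul X c x) = smul Y c (f x)"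
  using assms by (auto simp: linear_op_def)

lemma bounded_op_linear: "bounded_op X Y f \<Longrightarrow> linear_op X Y f"
  by (simp add: bounded_op_def)

lemmas bounded_op_vecs = linear_op_vecs[OF bounded_op_linear]
lemmas bounded_op_add = linear_op_add[OF bounded_op_linear]
lemmas bounded_op_smul = linear_op_smul[OF bounded_op_linear]

lemma bounded_op_bound:
  assumes "banach_space X" "bounded_op X Y f"
  obtains C where "C > 0" "\<And>x. x \<in> vecs X \<Longrightarrow> nrm Y (f x) \<le> C * nrm X x"
proof -
  obtain C where C: "\<forall>x\<in>vecs X. nrm Y (f x) \<le> C * nrm X x"
    using assms(2) by (auto simp: bounded_op_def)
  show ?thesis
  proof (rule that[of "max C 1"])
    fix x assume x: "x \<in> vecs X"
    have "C * nrm X x \<le> max C 1 * nrm X x"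
      by (intro mult_right_mono nrm_nonneg assms x) auto
    then show "nrm Y (f x) \<le> max C 1 * nrm X x" using C x by force
  qed simp
qed

lemma linear_op_zero:
  assumes "banach_space X" "linear_op X Y f"
  shows "f 0 = 0"
  using linear_op_add[OF assms(2) zero_vecs[OF assms(1)] zero_vecs[OF assms(1)]] by simp

lemma linear_op_diff:
  assumes "banach_space X" "linear_op X Y f" "x \<in> vecs X" "y \<in> vecs X"
  shows "f (x - y) = f x - f y"
  using linear_op_add[OF assms(2) minus_vecs[OF assms(1,3,4)] assms(4)] by simp

lemma linear_op_sum:
  assumes "banach_space X" "linear_op X Y f" "\<And>i. i \<in> I \<Longrightarrow> g i \<in> vecs X"
  shows "f (sum g I) = (\<Sum>i\<in>I. f (g i))"
  using assms(3)
  by (induction I rule: infinite_finite_induct)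
    (auto simp: linear_op_zero[OF assms(1,2)] linear_op_add[OF assms(2)] sum_vecs[OF assms(1)])

lemma bounded_op_cong:
  assumes "bounded_op X Y f" "banach_space X" "\<And>x. x \<in> vecs X \<Longrightarrow> g x = f x"
  shows "bounded_op X Y g"
  using assms by (auto simp: bounded_op_def linear_op_def add_vecs smul_vecs)

lemma bounded_op_id: "bounded_op X X (\<lambda>x. x)"
  by (rule bounded_opI[where C=1]) auto

lemma bounded_op_compose:
  assumes "banach_space X" "banach_space Y" "bounded_op X Y f" "bounded_op Y W g"
  shows "bounded_op X W (\<lambda>x. g (f x))"
proof -
  obtain C where C: "C > 0" "\<And>x. x \<in> vecs X \<Longrightarrow> nrm Y (f x) \<le> C * nrm X x"
    using bounded_op_bound[OF assms(1,3)] by blast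
  obtain D where D: "D > 0" "\<And>x. x \<in> vecs Y \<Longrightarrow> nrm W (g x) \<le> D * nrm Y x"
    using bounded_op_bound[OF assms(2,4)] by blast
  show ?thesis
  proof (rule bounded_opI[where C="D * C"])
    fix x assume x: "x \<in> vecs X"
    have "nrm W (g (f x)) \<le> D * nrm Y (f x)"
      by (rule D(2)) (rule bounded_op_vecs[OF assms(3) x])
    also have "\<dots> \<le> D * (C * nrm X x)" using C(2)[OF x] D(1) by simp
    finally show "nrm W (g (f x)) \<le> D * C * nrm X x" by (simp add: mult.assoc)
  qed (auto simp: bounded_op_vecs[OF assms(3)] bounded_op_vecs[OF assms(4)]
      bounded_op_add[OF assms(3)] bounded_op_add[OF assms(4)]
      bounded_op_smul[OF assms(3)] bounded_op_smul[OF assms(4)])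
qed

lemma bounded_op_plus:
  assumes "banach_space X" "banach_space Y" "bounded_op X Y f" "bounded_op X Y g"
  shows "bounded_op X Y (\<lambda>x. f x + g x)"
proof -
  obtain C where C: "C > 0" "\<And>x. x \<in> vecs X \<Longrightarrow> nrm Y (f x) \<le> C * nrm X x"
    using bounded_op_bound[OF assms(1,3)] by blast
  obtain D where D: "D > 0" "\<And>x. x \<in> vecs X \<Longrightarrow> nrm Y (g x) \<le> D * nrm X x"
    using bounded_op_bound[OF assms(1,4)] by blast
  show ?thesis
  proof (rule bounded_opI[where C="C + D"])
    fix x assume x: "x \<in> vecs X"
    have "nrm Y (f x + g x) \<le> nrm Y (f x) + nrm Y (g x)"
      by (intro nrm_triangle assms bounded_op_vecs[OF _ x])
    then show "nrm Y (f x + g x) \<le> (C + D) * nrm X x"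
      using C(2)[OF x] D(2)[OF x] by (simp add: distrib_right)
  qed (auto simp: bounded_op_vecs[OF assms(3)] bounded_op_vecs[OF assms(4)] add_vecs[OF assms(2)]
      bounded_op_add[OF assms(3)] bounded_op_add[OF assms(4)] smul_add_right[OF assms(2)]
      bounded_op_smul[OF assms(3)] bounded_op_smul[OF assms(4)])
qed

lemma bounded_op_uminus:
  assumes "banach_space Y" "bounded_op X Y f"
  shows "bounded_op X Y (\<lambda>x. - f x)"
proof -
  obtain C where C: "\<forall>x\<in>vecs X. nrm Y (f x) \<le> C * nrm X x"
    using assms(2) by (auto simp: bounded_op_def)
  have neg: "- v = smul Y (-1) v" for v by (simp add: smul_minus_one[OF assms(1)])
  show ?thesis unfolding neg
    by (rule bounded_opI[where C=C])
      (use C in \<open>auto simp: smul_vecs[OF assms(1)] bounded_op_vecs[OF assms(2)]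
        bounded_op_add[OF assms(2)] bounded_op_smul[OF assms(2)] smul_add_right[OF assms(1)]
        smul_smul[OF assms(1)] nrm_smul[OF assms(1)]\<close>)
qed

lemma bounded_op_minus:
  assumes "banach_space X" "banach_space Y" "bounded_op X Y f" "bounded_op X Y g"
  shows "bounded_op X Y (\<lambda>x. f x - g x)"
  using bounded_op_plus[OF assms(1-3) bounded_op_uminus[OF assms(2,4)]] by simp

lemma op_norm_bound:
  assumes "banach_space X" "bounded_op X Y f" "x \<in> vecs X"
  shows "nrm Y (f x) \<le> op_norm X Y f * nrm X x"
proof (cases "x = 0")
  case True
  obtain C where "nrm Y (f x) \<le> C * nrm X x"
    using assms by (auto simp: bounded_op_def)
  then show ?thesis using True by (simp add: nrm_zero[OF assms(1)])
next
  case False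
  obtain C where C: "C > 0" "\<And>x. x \<in> vecs X \<Longrightarrow> nrm Y (f x) \<le> C * nrm X x"
    using bounded_op_bound[OF assms(1,2)] by blast
  have "bdd_above ((\<lambda>x. nrm Y (f x) / nrm X x) ` vecs X)"
  proof (rule bdd_aboveI2)
    fix x assume x: "x \<in> vecs X"
    then show "nrm Y (f x) / nrm X x \<le> C"
      using C(2)[OF x] C(1) nrm_nonneg[OF assms(1) x]
      by (cases "nrm X x = 0") (auto simp: divide_le_eq)
  qed
  from cSUP_upper[OF assms(3) this] have "nrm Y (f x) / nrm X x \<le> op_norm X Y f"
    by (simp add: op_norm_def)
  moreover have "nrm X x > 0"
    using False nrm_nonneg[OF assms(1,3)] nrm_eq_0[OF assms(1,3)] by linarith
  ultimately show ?thesis by (simp add: divide_le_eq)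
qed

text \<open>The lower bound is what makes products of such norms estimable. The bounds are stated on values, since
the lemma is meant for \<open>\<ell>\<^sup>p\<close>, whose Banach space structure would require the Minkowski inequality.\<close>

lemma op_norm_nonneg_le_1:
  assumes "vecs X \<noteq> {}" "\<And>x. x \<in> vecs X \<Longrightarrow> 0 \<le> nrm Y (f x)"
    and "\<And>x. x \<in> vecs X \<Longrightarrow> nrm Y (f x) \<le> nrm X x"
  shows "0 \<le> op_norm X Y f" "op_norm X Y f \<le> 1"
proof -
  have q: "0 \<le> nrm Y (f x) / nrm X x \<and> nrm Y (f x) / nrm X x \<le> 1" if "x \<in> vecs X" for x
    using assms(2,3)[OF that] by (auto simp: divide_le_eq)
  show "op_norm X Y f \<le> 1"
    unfolding op_norm_def by (rule cSUP_least) (use assms(1) q in auto)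
  obtain x where x: "x \<in> vecs X" using assms(1) by blast
  have "bdd_above ((\<lambda>x. nrm Y (f x) / nrm X x) ` vecs X)"
    by (rule bdd_aboveI2[where M=1]) (use q in auto)
  from cSUP_upper[OF x this] q[OF x] show "0 \<le> op_norm X Y f"
    unfolding op_norm_def by linarith
qed

section \<open>Series\<close>

lemma sums_in_unique:
  assumes "banach_space X" "\<And>n. f n \<in> vecs X" "sums_in X f s" "sums_in X f s'"
  shows "s = s'"
proof -
  have s: "s \<in> vecs X" "s' \<in> vecs X" using assms by (auto simp: sums_in_def)
  have p: "(\<Sum>n<N. f n) \<in> vecs X" for N by (rule sum_vecs) (use assms in auto)
  have "(\<lambda>N. nrm X ((\<Sum>n<N. f n) - s) + nrm X ((\<Sum>n<N. f n) - s')) \<longlonglongrightarrow> 0 + 0"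
    using assms(3,4) by (intro tendsto_add) (auto simp: sums_in_def)
  moreover have "\<exists>M. \<forall>N\<ge>M. nrm X (s - s') \<le> nrm X ((\<Sum>n<N. f n) - s) + nrm X ((\<Sum>n<N. f n) - s')"
    using nrm_triangle_diff[OF assms(1) s(1) p s(2)] nrm_commute[OF assms(1) s(1) p] by simp
  ultimately have "nrm X (s - s') \<le> 0 + 0"
    by (rule LIMSEQ_le_const)
  then show ?thesis
    by (intro eq_if_nrm_arbitrarily_small[OF assms(1) s]) simp
qed

lemma the_sums_in:
  assumes "banach_space X" "\<And>n. f n \<in> vecs X" "sums_in X f s"
  shows "(THE s. sums_in X f s) = s"
  by (rule the_equality, rule assms(3), rule sums_in_unique[OF assms(1,2) _ assms(3)])

lemma sums_in_the:
  assumes "banach_space X" "\<And>n. f n \<in> vecs X" "\<exists>s. sums_in X f s"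
  shows "sums_in X f (THE s. sums_in X f s)"
proof -
  obtain s where "sums_in X f s" using assms(3) by blast
  then show ?thesis by (simp only: the_sums_in[OF assms(1,2)])
qed

lemma sums_in_bounded_op:
  assumes "banach_space X" "banach_space Y" "bounded_op X Y T"
    and f: "\<And>n. f n \<in> vecs X" and s: "sums_in X f s"
  shows "sums_in Y (\<lambda>n. T (f n)) (T s)"
proof -
  obtain C where C: "C > 0" "\<And>x. x \<in> vecs X \<Longrightarrow> nrm Y (T x) \<le> C * nrm X x"
    using bounded_op_bound[OF assms(1,3)] by blast
  note lin = bounded_op_linear[OF assms(3)]
  have sv: "s \<in> vecs X" and lim: "(\<lambda>N. nrm X ((\<Sum>n<N. f n) - s)) \<longlonglongrightarrow> 0"
    using s by (auto simp: sums_in_def)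
  have p: "(\<Sum>n<N. f n) \<in> vecs X" for N by (rule sum_vecs[OF assms(1)]) (rule f)
  have eq: "(\<Sum>n<N. T (f n)) - T s = T ((\<Sum>n<N. f n) - s)" for N
    by (simp add: linear_op_sum[OF assms(1) lin f] linear_op_diff[OF assms(1) lin p sv])
  have d: "(\<Sum>n<N. f n) - s \<in> vecs X" for N by (rule minus_vecs[OF assms(1) p sv])
  have "(\<lambda>N. nrm Y ((\<Sum>n<N. T (f n)) - T s)) \<longlonglongrightarrow> 0"
  proof (rule tendsto_sandwich[where f="\<lambda>_. 0"])
    show "(\<lambda>N. C * nrm X ((\<Sum>n<N. f n) - s)) \<longlonglongrightarrow> 0"
      using tendsto_mult_left[OF lim, of C] by simp
    show "\<forall>\<^sub>F N in sequentially. 0 \<le> nrm Y ((\<Sum>n<N. T (f n)) - T s)"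
      unfolding eq by (intro always_eventually allI nrm_nonneg assms linear_op_vecs[OF lin] d)
    show "\<forall>\<^sub>F N in sequentially.
        nrm Y ((\<Sum>n<N. T (f n)) - T s) \<le> C * nrm X ((\<Sum>n<N. f n) - s)"
      unfolding eq by (intro always_eventually allI C(2) d)
  qed simp
  then show ?thesis by (simp add: sums_in_def linear_op_vecs[OF lin sv])
qed

lemma sums_in_add:
  assumes "banach_space X" and f: "\<And>n. f n \<in> vecs X" and g: "\<And>n. g n \<in> vecs X"
    and s: "sums_in X f s" and r: "sums_in X g r"
  shows "sums_in X (\<lambda>n. f n + g n) (s + r)"
proof -
  have v: "s \<in> vecs X" "r \<in> vecs X" using s r by (auto simp: sums_in_def)
  have d: "(\<Sum>n<N. f n) - s \<in> vecs X" "(\<Sum>n<N. g n) - r \<in> vecs X" for N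
    by (intro minus_vecs assms(1) sum_vecs f g v)+
  have eq: "(\<Sum>n<N. f n + g n) - (s + r) = ((\<Sum>n<N. f n) - s) + ((\<Sum>n<N. g n) - r)" for N
    by (simp add: sum.distrib)
  have "(\<lambda>N. nrm X ((\<Sum>n<N. f n + g n) - (s + r))) \<longlonglongrightarrow> 0"
  proof (rule tendsto_sandwich[where f="\<lambda>_. 0"])
    show "(\<lambda>N. nrm X ((\<Sum>n<N. f n) - s) + nrm X ((\<Sum>n<N. g n) - r)) \<longlonglongrightarrow> 0"
      using tendsto_add[of _ 0 _ _ 0] s r by (auto simp: sums_in_def)
    show "\<forall>\<^sub>F N in sequentially. 0 \<le> nrm X ((\<Sum>n<N. f n + g n) - (s + r))"
      unfolding eq by (intro always_eventually allI nrm_nonneg assms(1) add_vecs d)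
    show "\<forall>\<^sub>F N in sequentially. nrm X ((\<Sum>n<N. f n + g n) - (s + r))
        \<le> nrm X ((\<Sum>n<N. f n) - s) + nrm X ((\<Sum>n<N. g n) - r)"
      unfolding eq by (intro always_eventually allI nrm_triangle assms(1) d)
  qed simp
  then show ?thesis by (simp add: sums_in_def add_vecs[OF assms(1) v])
qed

lemma sums_in_single:
  assumes "banach_space X" "v \<in> vecs X"
  shows "sums_in X (\<lambda>m. if m = n then v else 0) v"
proof -
  have "\<forall>\<^sub>F N in sequentially. nrm X ((\<Sum>m<N. if m = n then v else 0) - v) = 0"
    using eventually_gt_at_top[of n]
    by eventually_elim (simp add: sum.delta nrm_zero[OF assms(1)])
  then show ?thesis using assms(2) by (simp add: sums_in_def tendsto_eventually)
qed

section \<open>Kernels and direct sums\<close>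

definition kernel_space where
  "kernel_space X P = X\<lparr>vecs := {x \<in> vecs X. P x = 0}\<rparr>"

lemma kernel_space_simps [simp]:
  "vecs (kernel_space X P) = {x \<in> vecs X. P x = 0}"
  "smul (kernel_space X P) = smul X" "nrm (kernel_space X P) = nrm X"
  by (simp_all add: kernel_space_def)

definition direct_sum where
  "direct_sum X W = \<lparr>vecs = vecs X \<times> vecs W,
     smul = (\<lambda>c (x, w). (smul X c x, smul W c w)), nrm = (\<lambda>(x, w). nrm X x + nrm W w)\<rparr>"

lemma direct_sum_simps [simp]:
  "vecs (direct_sum X W) = vecs X \<times> vecs W"
  "smul (direct_sum X W) c (x, w) = (smul X c x, smul W c w)"
  "nrm (direct_sum X W) (x, w) = nrm X x + nrm W w"
  by (simp_all add: direct_sum_def)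

lemma banach_space_kernel:
  assumes X: "banach_space X" and Y: "banach_space Y" and P: "bounded_op X Y P"
  shows "banach_space (kernel_space X P)"
proof -
  note lin = bounded_op_linear[OF P]
  interpret vector_space "smul X" using X by (simp add: banach_space_def)
  have "subspace {x \<in> vecs X. P x = 0}"
    by (auto simp: subspace_def zero_vecs[OF X] add_vecs[OF X] smul_vecs[OF X]
        linear_op_zero[OF X lin] linear_op_add[OF lin] linear_op_smul[OF lin] smul_zero_right[OF Y])
  moreover have "\<exists>l. l \<in> vecs X \<and> P l = 0 \<and> (\<lambda>n. nrm X (f n - l)) \<longlonglongrightarrow> 0"
    if f: "range f \<subseteq> {x \<in> vecs X. P x = 0}"
      and c: "\<forall>e>0. \<exists>M. \<forall>m\<ge>M. \<forall>n\<ge>M. nrm X (f m - f n) < e" for f :: "nat \<Rightarrow> _"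
  proof -
    have fv: "f n \<in> vecs X" "P (f n) = 0" for n using f by auto
    obtain l where l: "l \<in> vecs X" "(\<lambda>n. nrm X (f n - l)) \<longlonglongrightarrow> 0"
      using banach_space_complete[OF X, of f] fv c by blast
    obtain C where C: "C > 0" "\<And>x. x \<in> vecs X \<Longrightarrow> nrm Y (P x) \<le> C * nrm X x"
      using bounded_op_bound[OF X P] by blast
    have Pl: "P l \<in> vecs Y" by (rule linear_op_vecs[OF lin l(1)])
    \<comment> \<open>The operator vanishes along the sequence, and continuity carries this to the limit.\<close>
    have bound: "nrm Y (P l) \<le> C * nrm X (f n - l)" for n
      using C(2)[OF minus_vecs[OF X fv(1) l(1)], of n] nrm_uminus[OF Y Pl]
      by (simp add: linear_op_diff[OF X lin fv(1) l(1)] fv)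
    have "(\<lambda>n. C * nrm X (f n - l)) \<longlonglongrightarrow> 0"
      using tendsto_mult_left[OF l(2), of C] by simp
    then have "nrm Y (P l) \<le> 0" by (rule LIMSEQ_le_const) (use bound in blast)
    then have "P l = 0" using nrm_nonneg[OF Y Pl] nrm_eq_0[OF Y Pl] by auto
    with l show ?thesis by blast
  qed
  ultimately show ?thesis
    using X unfolding banach_space_def kernel_space_simps Bex_def mem_Collect_eq
    by (simp add: image_subset_iff)
qed

lemma banach_space_direct_sum:
  assumes X: "banach_space X" and W: "banach_space W"
  shows "banach_space (direct_sum X W)"
proof -
  let ?D = "direct_sum X W"
  have V: "vector_space (smul ?D)"
    by (unfold_locales)
      (auto simp: smul_add_right[OF X] smul_add_right[OF W] smul_add_left[OF X]
        smul_add_left[OF W] smul_smul[OF X] smul_smul[OF W] smul_one[OF X] smul_one[OF W])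
  interpret vector_space "smul ?D" by (rule V)
  have S: "subspace (vecs ?D)"
    by (auto simp: subspace_def zero_prod_def zero_vecs X W add_vecs smul_vecs)
  have C: "\<exists>l\<in>vecs ?D. (\<lambda>n. nrm ?D (f n - l)) \<longlonglongrightarrow> 0"
    if f: "range f \<subseteq> vecs ?D"
      and c: "\<forall>e>0. \<exists>M. \<forall>m\<ge>M. \<forall>n\<ge>M. nrm ?D (f m - f n) < e" for f :: "nat \<Rightarrow> _"
  proof -
    have fv: "fst (f n) \<in> vecs X" "snd (f n) \<in> vecs W" for n
      using f by (auto simp: mem_Times_iff image_subset_iff)
    have nD: "nrm ?D u = nrm X (fst u) + nrm W (snd u)" for u
      by (cases u) simp
    have nn: "0 \<le> nrm X (fst (f m) - fst (f n))" "0 \<le> nrm W (snd (f m) - snd (f n))" for m n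
      by (intro nrm_nonneg X W minus_vecs fv)+
    have "\<exists>l\<in>vecs X. (\<lambda>n. nrm X (fst (f n) - l)) \<longlonglongrightarrow> 0"
    proof (rule banach_space_complete[OF X fv(1)])
      fix e :: real assume "e > 0"
      then obtain M where M: "\<forall>m\<ge>M. \<forall>n\<ge>M. nrm ?D (f m - f n) < e" using c by blast
      show "\<exists>M. \<forall>m\<ge>M. \<forall>n\<ge>M. nrm X (fst (f m) - fst (f n)) < e"
      proof (intro exI allI impI)
        fix m n assume "m \<ge> M" "n \<ge> M"
        then have "nrm ?D (f m - f n) < e" using M by blast
        then show "nrm X (fst (f m) - fst (f n)) < e" using nn(2)[of m n] by (simp add: nD)
      qed
    qed
    then obtain l where l: "l \<in> vecs X" "(\<lambda>n. nrm X (fst (f n) - l)) \<longlonglongrightarrow> 0" by blast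
    have "\<exists>k\<in>vecs W. (\<lambda>n. nrm W (snd (f n) - k)) \<longlonglongrightarrow> 0"
    proof (rule banach_space_complete[OF W fv(2)])
      fix e :: real assume "e > 0"
      then obtain M where M: "\<forall>m\<ge>M. \<forall>n\<ge>M. nrm ?D (f m - f n) < e" using c by blast
      show "\<exists>M. \<forall>m\<ge>M. \<forall>n\<ge>M. nrm W (snd (f m) - snd (f n)) < e"
      proof (intro exI allI impI)
        fix m n assume "m \<ge> M" "n \<ge> M"
        then have "nrm ?D (f m - f n) < e" using M by blast
        then show "nrm W (snd (f m) - snd (f n)) < e" using nn(1)[of m n] by (simp add: nD)
      qed
    qed
    then obtain k where k: "k \<in> vecs W" "(\<lambda>n. nrm W (snd (f n) - k)) \<longlonglongrightarrow> 0" by blast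
    have "(\<lambda>n. nrm ?D (f n - (l, k))) \<longlonglongrightarrow> 0"
      using tendsto_add[OF l(2) k(2)] by (simp add: nD)
    with l k show ?thesis by auto
  qed
  have T: "nrm ?D (u + v) \<le> nrm ?D u + nrm ?D v" if "u \<in> vecs ?D" "v \<in> vecs ?D" for u v
  proof (cases u, cases v)
    fix a b c d assume "u = (a, b)" "v = (c, d)"
    with that show ?thesis using nrm_triangle[OF X, of a c] nrm_triangle[OF W, of b d] by auto
  qed
  have Z: "nrm ?D u = 0 \<longleftrightarrow> u = 0" if "u \<in> vecs ?D" for u
    using that nrm_eq_0[OF X, of "fst u"] nrm_eq_0[OF W, of "snd u"]
      nrm_nonneg[OF X, of "fst u"] nrm_nonneg[OF W, of "snd u"]
    by (cases u) (auto simp: zero_prod_def)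
  show ?thesis
    unfolding banach_space_def
  proof (intro conjI V S ballI allI impI)
    fix u assume u: "u \<in> vecs ?D"
    then show "0 \<le> nrm ?D u"
      by (cases u) (auto intro: add_nonneg_nonneg nrm_nonneg X W)
    show "(nrm ?D u = 0) = (u = 0)" by (rule Z[OF u])
    show "nrm ?D (smul ?D c u) = norm c * nrm ?D u" for c
      using u by (cases u) (auto simp: nrm_smul X W distrib_left)
  qed (use T C in auto)
qed

lemma bounded_op_kernel_inclusion: "bounded_op (kernel_space X P) X (\<lambda>x. x)"
  by (rule bounded_opI[where C=1]) auto

lemma bounded_op_into_kernel:
  assumes "bounded_op X Y f" "\<And>x. x \<in> vecs X \<Longrightarrow> P (f x) = 0"
  shows "bounded_op X (kernel_space Y P) f"
  using assms by (auto simp: bounded_op_def linear_op_def)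

lemma
  assumes "banach_space X" "banach_space W"
  shows bounded_op_fst: "bounded_op (direct_sum X W) X fst"
    and bounded_op_snd: "bounded_op (direct_sum X W) W snd"
proof -
  show "bounded_op (direct_sum X W) X fst"
    by (rule bounded_opI[where C=1]) (auto simp: nrm_nonneg[OF assms(2)])
  show "bounded_op (direct_sum X W) W snd"
    by (rule bounded_opI[where C=1]) (auto simp: nrm_nonneg[OF assms(1)])
qed

lemma bounded_op_Pair:
  assumes "banach_space V" "bounded_op V X f" "bounded_op V W g"
  shows "bounded_op V (direct_sum X W) (\<lambda>v. (f v, g v))"
proof -
  obtain C where C: "C > 0" "\<And>x. x \<in> vecs V \<Longrightarrow> nrm X (f x) \<le> C * nrm V x"
    using bounded_op_bound[OF assms(1,2)] by blast
  obtain D where D: "D > 0" "\<And>x. x \<in> vecs V \<Longrightarrow> nrm W (g x) \<le> D * nrm V x"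
    using bounded_op_bound[OF assms(1,3)] by blast
  show ?thesis
  proof (rule bounded_opI[where C="C + D"])
    fix x assume x: "x \<in> vecs V"
    show "nrm (direct_sum X W) (f x, g x) \<le> (C + D) * nrm V x"
      using C(2)[OF x] D(2)[OF x] by (simp add: distrib_right)
  qed (auto simp: bounded_op_vecs[OF assms(2)] bounded_op_vecs[OF assms(3)]
      bounded_op_add[OF assms(2)] bounded_op_add[OF assms(3)]
      bounded_op_smul[OF assms(2)] bounded_op_smul[OF assms(3)])
qed

lemma sums_in_direct_sum:
  assumes "sums_in X f s" "sums_in W g r"
  shows "sums_in (direct_sum X W) (\<lambda>n. (f n, g n)) (s, r)"
proof -
  have eq: "(\<Sum>n<N. (f n, g n)) - (s, r) = ((\<Sum>n<N. f n) - s, (\<Sum>n<N. g n) - r)" for N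
    by (auto simp: sum_prod)
  have "(\<lambda>N. nrm X ((\<Sum>n<N. f n) - s) + nrm W ((\<Sum>n<N. g n) - r)) \<longlonglongrightarrow> 0 + 0"
    using assms by (intro tendsto_add) (auto simp: sums_in_def)
  then show ?thesis
    using assms by (simp add: sums_in_def eq)
qed

section \<open>Restricting sequences to a set of indices\<close>

text \<open>Restrictions to arbitrary index sets serve three purposes: one index gives a coordinate map, an
initial segment a partial sum, and a final segment the remainder of a series.\<close>

definition restrict_seq :: "nat set \<Rightarrow> (nat \<Rightarrow> 'k::real_normed_field) \<Rightarrow> nat \<Rightarrow> 'k" where
  "restrict_seq F a = (\<lambda>m. if m \<in> F then a m else 0)"

lemma lp_space_simps [simp]:
  "vecs (lp_space p) = {a. summable (\<lambda>n. norm (a n) powr p)}"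
  "smul (lp_space p) c a = (\<lambda>n. c * a n)"
  "nrm (lp_space p) a = (\<Sum>n. norm (a n) powr p) powr (1 / p)"
  by (simp_all add: lp_space_def)

lemma
  fixes a :: "nat \<Rightarrow> 'k::real_normed_field"
  assumes "1 \<le> p" "a \<in> vecs (lp_space p)"
  shows restrict_seq_in_lp: "restrict_seq F a \<in> vecs (lp_space p)"
    and nrm_restrict_seq_le: "nrm (lp_space p) (restrict_seq F a) \<le> nrm (lp_space p) a"
proof -
  have le: "norm (restrict_seq F a m) powr p \<le> norm (a m) powr p" for m
    by (simp add: restrict_seq_def)
  have s: "summable (\<lambda>m. norm (a m) powr p)" using assms by simp
  have s': "summable (\<lambda>m. norm (restrict_seq F a m) powr p)"
    by (rule summable_comparison_test'[OF s, of 0]) (use le in simp)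
  then show "restrict_seq F a \<in> vecs (lp_space p)" by simp
  have "(\<Sum>m. norm (restrict_seq F a m) powr p) \<le> (\<Sum>m. norm (a m) powr p)"
    by (rule suminf_le[OF le s' s])
  moreover have "0 \<le> (\<Sum>m. norm (restrict_seq F a m) powr p)"
    by (rule suminf_nonneg[OF s']) simp
  ultimately show "nrm (lp_space p) (restrict_seq F a) \<le> nrm (lp_space p) a"
    using assms(1) by (auto intro: powr_mono2)
qed

lemma bounded_op_restrict_seq:
  assumes "1 \<le> p"
  shows "bounded_op (lp_space p) (lp_space p)
    (restrict_seq F :: (nat \<Rightarrow> 'k::real_normed_field) \<Rightarrow> nat \<Rightarrow> 'k)"
proof (rule bounded_opI[where C=1])
  fix a :: "nat \<Rightarrow> 'k" assume a: "a \<in> vecs (lp_space p)"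
  show "restrict_seq F a \<in> vecs (lp_space p)" by (rule restrict_seq_in_lp[OF assms a])
  show "nrm (lp_space p) (restrict_seq F a) \<le> 1 * nrm (lp_space p) a"
    using nrm_restrict_seq_le[OF assms a] by simp
qed (auto simp: restrict_seq_def fun_eq_iff)

lemma restrict_seq_singleton:
  "restrict_seq {n} a = smul (lp_space p) (a n) (unit_seq n)"
  by (auto simp: restrict_seq_def unit_seq_def)

lemma
  shows unit_seq_in_lp: "(unit_seq n :: nat \<Rightarrow> 'k::real_normed_field) \<in> vecs (lp_space p)"
    and nrm_unit_seq: "nrm (lp_space p) (unit_seq n :: nat \<Rightarrow> 'k) = 1"
proof -
  have eq: "norm (unit_seq n m :: 'k) powr p = (if m = n then 1 else 0)" for m
    by (simp add: unit_seq_def)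
  have "(\<lambda>m. norm (unit_seq n m :: 'k) powr p) sums 1"
    unfolding eq using sums_single[of n "\<lambda>_. 1"] by simp
  then show "(unit_seq n :: nat \<Rightarrow> 'k) \<in> vecs (lp_space p)"
    "nrm (lp_space p) (unit_seq n :: nat \<Rightarrow> 'k) = 1"
    by (auto simp: sums_iff)
qed

lemma nrm_lp_tail_tendsto_0:
  fixes a :: "nat \<Rightarrow> 'k::real_normed_field"
  assumes "1 \<le> p" "a \<in> vecs (lp_space p)"
  shows "(\<lambda>N. nrm (lp_space p) (restrict_seq {N..} a)) \<longlonglongrightarrow> 0"
proof -
  let ?g = "\<lambda>m. norm (a m) powr p"
  have s: "summable ?g" using assms by simp
  have "(\<lambda>m. norm (restrict_seq {N..} a m) powr p) sums (suminf ?g - sum ?g {..<N})" for N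
  proof -
    have "(\<lambda>m. if m \<in> {..<N} then ?g m else 0) sums sum ?g {..<N}"
      by (rule sums_If_finite_set) simp
    from sums_diff[OF summable_sums[OF s] this] show ?thesis
      by (rule sums_cong[THEN iffD1, rotated]) (auto simp: restrict_seq_def)
  qed
  then have eq: "(\<Sum>m. norm (restrict_seq {N..} a m) powr p) = suminf ?g - sum ?g {..<N}" for N
    by (simp add: sums_iff)
  have lim: "(\<lambda>N. suminf ?g - sum ?g {..<N}) \<longlonglongrightarrow> 0"
    using tendsto_diff[OF tendsto_const summable_LIMSEQ[OF s], of "suminf ?g"] by simp
  show ?thesis
    unfolding lp_space_simps eq
  proof (rule tendsto_zero_powrI[OF lim tendsto_const])
    show "\<forall>\<^sub>F N in sequentially. 0 \<le> suminf ?g - sum ?g {..<N}"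
      using sum_le_suminf[OF s] by auto
    show "0 < 1 / p" using assms(1) by simp
  qed
qed

section \<open>The completed tensor product\<close>

lemma
  assumes "tensor_completion p Y Z t"
  shows tensor_banach_space: "banach_space Z"
    and linear_op_tensor_right: "a \<in> vecs (lp_space p) \<Longrightarrow> linear_op Y Z (t a)"
    and linear_op_tensor_left: "y \<in> vecs Y \<Longrightarrow> linear_op (lp_space p) Z (\<lambda>a. t a y)"
    and nrm_tensor: "\<lbrakk>a \<in> vecs (lp_space p); y \<in> vecs Y\<rbrakk>
      \<Longrightarrow> nrm Z (t a y) = nrm (lp_space p) a * nrm Y y"
  using assms unfolding tensor_completion_def bilinear_op_def by blast+

lemma tensor_dense:
  assumes "tensor_completion p Y Z t" "z \<in> vecs Z" "e > 0"
  obtains m :: nat and a y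
  where "\<And>i. i < m \<Longrightarrow> a i \<in> vecs (lp_space p)" "\<And>i. i < m \<Longrightarrow> y i \<in> vecs Y"
    "nrm Z (z - (\<Sum>i<m. t (a i) (y i))) < e"
proof -
  have "\<forall>z\<in>vecs Z. \<forall>e>0. \<exists>m a y.
      (\<forall>i<m::nat. a i \<in> vecs (lp_space p) \<and> y i \<in> vecs Y) \<and>
      nrm Z (z - (\<Sum>i<m. t (a i) (y i))) < e"
    using assms(1) unfolding tensor_completion_def by (elim conjE)
  from this[THEN bspec, OF assms(2), THEN spec, THEN mp, OF assms(3)] that show ?thesis
    by blast
qed

lemma tensor_in_vecs:
  assumes "tensor_completion p Y Z t" "a \<in> vecs (lp_space p)" "y \<in> vecs Y"
  shows "t a y \<in> vecs Z"
  using linear_op_vecs[OF linear_op_tensor_right[OF assms(1,2)] assms(3)] .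

text \<open>Every fact about the completed tensor product below holds on elementary tensors by computation and
spreads from there; this rule separates the computation from the spreading. Elementary tensors absorb
scalars, so finite sums of them already form the dense subspace.\<close>

lemma tensor_completion_induct [consumes 2, case_names tensor zero add limit]:
  assumes tc: "tensor_completion p Y Z t" and z: "z \<in> vecs Z"
    and elem: "\<And>a y. \<lbrakk>a \<in> vecs (lp_space p); y \<in> vecs Y\<rbrakk> \<Longrightarrow> Q (t a y)"
    and zero: "Q 0"
    and add: "\<And>u v. \<lbrakk>u \<in> vecs Z; v \<in> vecs Z; Q u; Q v\<rbrakk> \<Longrightarrow> Q (u + v)"
    and limit: "\<And>z. \<lbrakk>z \<in> vecs Z; \<And>e. e > 0 \<Longrightarrow> \<exists>w\<in>vecs Z. Q w \<and> nrm Z (z - w) < e\<rbrakk> \<Longrightarrow> Q z"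
  shows "Q z"
proof (rule limit[OF z])
  fix e :: real assume "e > 0"
  then obtain m :: nat and a y
    where ay: "\<And>i. i < m \<Longrightarrow> a i \<in> vecs (lp_space p)" "\<And>i. i < m \<Longrightarrow> y i \<in> vecs Y"
      and e: "nrm Z (z - (\<Sum>i<m. t (a i) (y i))) < e"
    using tensor_dense[OF tc z] by blast
  have Zk: "(\<Sum>i<k. t (a i) (y i)) \<in> vecs Z" if "k \<le> m" for k
    by (intro sum_vecs[OF tensor_banach_space[OF tc]] tensor_in_vecs[OF tc] ay) (use that in auto)
  have "k \<le> m \<Longrightarrow> Q (\<Sum>i<k. t (a i) (y i))" for k
  proof (induction k)
    case 0
    show ?case using zero by simp
  next
    case (Suc k)
    then have k: "a k \<in> vecs (lp_space p)" "y k \<in> vecs Y" "k \<le> m" using ay by auto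
    show ?case
      using add[OF Zk[OF k(3)] tensor_in_vecs[OF tc k(1,2)] Suc.IH[OF k(3)] elem[OF k(1,2)]]
      by (simp only: sum.lessThan_Suc)
  qed
  note this[OF order_refl] Zk[OF order_refl]
  with e show "\<exists>w\<in>vecs Z. Q w \<and> nrm Z (z - w) < e" by blast
qed

lemma bounded_op_eq_on_tensor:
  assumes tc: "tensor_completion p Y Z t" and W: "banach_space W"
    and U: "bounded_op Z W U" and V: "bounded_op Z W V"
    and eq: "\<And>a y. \<lbrakk>a \<in> vecs (lp_space p); y \<in> vecs Y\<rbrakk> \<Longrightarrow> U (t a y) = V (t a y)"
    and z: "z \<in> vecs Z"
  shows "U z = V z"
proof -
  note Z = tensor_banach_space[OF tc]
  let ?D = "\<lambda>z. U z - V z"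
  have D: "bounded_op Z W ?D" by (rule bounded_op_minus[OF Z W U V])
  obtain C where C: "C > 0" "\<And>z. z \<in> vecs Z \<Longrightarrow> nrm W (?D z) \<le> C * nrm Z z"
    using bounded_op_bound[OF Z D] by blast
  have "?D z = 0" using tc z
  proof (induction rule: tensor_completion_induct)
    case (tensor a y)
    then show ?case by (simp add: eq)
  next
    case zero
    show ?case by (rule linear_op_zero[OF Z bounded_op_linear[OF D]])
  next
    case (add u v)
    then show ?case using bounded_op_add[OF D add(1,2)] by simp
  next
    case (limit z)
    show ?case
    proof (rule eq_if_nrm_arbitrarily_small[OF W bounded_op_vecs[OF D limit(1)] zero_vecs[OF W]])
      fix e :: real assume "e > 0"
      then obtain w where w: "w \<in> vecs Z" "?D w = 0" "nrm Z (z - w) < e / C"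
        using limit(2)[of "e / C"] C(1) by auto
      have "nrm W (?D z - 0) = nrm W (?D (z - w))"
        using linear_op_diff[OF Z bounded_op_linear[OF D] limit(1) w(1)] w(2) by simp
      also have "\<dots> \<le> C * nrm Z (z - w)" by (rule C(2)[OF minus_vecs[OF Z limit(1) w(1)]])
      also have "\<dots> \<le> e" using w(3) C(1) by (simp add: field_simps)
      finally show "nrm W (?D z - 0) \<le> e" .
    qed
  qed
  then show ?thesis by simp
qed

text \<open>This is where the tensor norm being uniform enters: coordinate restrictions and the identity of
\<open>Y\<close> have norm at most one, hence so has their tensor product. The bound is one also for the degenerate
space \<open>Y = 0\<close>, whose identity has norm zero.\<close>

lemma restriction_tensor_id:
  fixes Y :: "('k::{real_normed_field,banach}, 'y::ab_group_add) nspace"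
  assumes p: "1 \<le> p" and Y: "banach_space Y" and tc: "tensor_completion p Y Z t"
  obtains U where "bounded_op Z Z U"
    "\<And>a y. \<lbrakk>a \<in> vecs (lp_space p); y \<in> vecs Y\<rbrakk> \<Longrightarrow> U (t a y) = t (restrict_seq F a) y"
    "\<And>z. z \<in> vecs Z \<Longrightarrow> nrm Z (U z) \<le> nrm Z z"
proof -
  let ?T = "restrict_seq F :: (nat \<Rightarrow> 'k) \<Rightarrow> nat \<Rightarrow> 'k"
  let ?l = "lp_space p :: ('k, nat \<Rightarrow> 'k) nspace"
  note Z = tensor_banach_space[OF tc]
  have "\<forall>T R. bounded_op ?l ?l T \<longrightarrow> bounded_op Y Y R \<longrightarrow>
      (\<exists>U. bounded_op Z Z U \<and> (\<forall>a\<in>vecs ?l. \<forall>y\<in>vecs Y. U (t a y) = t (T a) (R y)) \<and>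
           op_norm Z Z U \<le> op_norm ?l ?l T * op_norm Y Y R)"
    using tc unfolding tensor_completion_def by (elim conjE)
  from this[rule_format, OF bounded_op_restrict_seq[OF p, of F] bounded_op_id[of Y]]
  obtain U where U: "bounded_op Z Z U"
      "\<forall>a\<in>vecs ?l. \<forall>y\<in>vecs Y. U (t a y) = t (?T a) y"
      "op_norm Z Z U \<le> op_norm ?l ?l ?T * op_norm Y Y (\<lambda>y. y)"
    by blast
  have T: "0 \<le> nrm ?l (?T a) \<and> nrm ?l (?T a) \<le> nrm ?l a" if "a \<in> vecs ?l" for a
    using nrm_restrict_seq_le[OF p that, of F] by simp
  have "vecs ?l \<noteq> {}" using unit_seq_in_lp[of 0 p] by blast
  note norm_T = op_norm_nonneg_le_1[of ?l ?l ?T, OF this T[THEN conjunct1] T[THEN conjunct2]]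
  have "vecs Y \<noteq> {}" using zero_vecs[OF Y] by blast
  note norm_id = op_norm_nonneg_le_1[of Y Y "\<lambda>y. y", OF this nrm_nonneg[OF Y] order_refl]
  have "op_norm ?l ?l ?T * op_norm Y Y (\<lambda>y. y) \<le> 1"
    by (rule mult_le_one[OF norm_T(2) norm_id])
  with U(3) have le1: "op_norm Z Z U \<le> 1" by linarith
  have "nrm Z (U z) \<le> nrm Z z" if z: "z \<in> vecs Z" for z
    using op_norm_bound[OF Z U(1) z] mult_right_mono[OF le1 nrm_nonneg[OF Z z]] by simp
  with that U(1,2) show ?thesis by blast
qed

section \<open>Coordinate embeddings, coordinate maps and reconstruction\<close>

lemma
  assumes "tensor_completion p Y Z t"
  shows bounded_op_L: "bounded_op Y Z (L_op t n)"
    and nrm_L_op: "y \<in> vecs Y \<Longrightarrow> nrm Z (L_op t n y) = nrm Y y"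
proof -
  have n: "nrm Z (L_op t n y) = nrm Y y" if "y \<in> vecs Y" for y
    using nrm_tensor[OF assms unit_seq_in_lp that, of n] nrm_unit_seq[of p n, where 'k='a]
    by (simp add: L_op_def del: lp_space_simps)
  show "nrm Z (L_op t n y) = nrm Y y" if "y \<in> vecs Y" by (rule n[OF that])
  have "L_op t n = t (unit_seq n)" by (auto simp: L_op_def)
  then have "linear_op Y Z (L_op t n)"
    using linear_op_tensor_right[OF assms unit_seq_in_lp] by simp
  then show "bounded_op Y Z (L_op t n)"
    using n by (auto simp: bounded_op_def intro!: exI[of _ 1])
qed

lemma L_op_inject:
  assumes Y: "banach_space Y" and tc: "tensor_completion p Y Z t"
    and y: "y \<in> vecs Y" "y' \<in> vecs Y" and eq: "L_op t n y = L_op t n y'"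
  shows "y = y'"
proof (rule eq_if_nrm_arbitrarily_small[OF Y y])
  fix e :: real assume "e > 0"
  have "nrm Y (y - y') = nrm Z (L_op t n (y - y'))"
    by (rule nrm_L_op[OF tc minus_vecs[OF Y y], symmetric])
  also have "\<dots> = 0"
    using linear_op_diff[OF Y bounded_op_linear[OF bounded_op_L[OF tc]] y] eq
      nrm_zero[OF tensor_banach_space[OF tc]] by simp
  finally show "nrm Y (y - y') \<le> e" using \<open>e > 0\<close> by simp
qed

lemma tensor_restrict_singleton:
  assumes tc: "tensor_completion p Y Z t" and a: "a \<in> vecs (lp_space p)" and y: "y \<in> vecs Y"
  shows "t (restrict_seq {n} a) y = L_op t n (smul Y (a n) y)"
  unfolding restrict_seq_singleton[of n a p] L_op_def
  using linear_op_smul[OF linear_op_tensor_left[OF tc y] unit_seq_in_lp]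
    linear_op_smul[OF linear_op_tensor_right[OF tc unit_seq_in_lp] y] by simp

text \<open>On finite sums of elementary tensors the operator visibly takes values of the form \<open>L n y\<close>. For a
limit, the \<open>y\<close> of an approximating sequence form a Cauchy sequence because \<open>L n\<close> is isometric, and
completeness of \<open>Y\<close> provides the missing vector.\<close>

lemma range_coordinate_op:
  assumes Y: "banach_space Y" and tc: "tensor_completion p Y Z t"
    and U: "bounded_op Z Z U" "\<And>z. z \<in> vecs Z \<Longrightarrow> nrm Z (U z) \<le> nrm Z z"
    and Ut: "\<And>a y. \<lbrakk>a \<in> vecs (lp_space p); y \<in> vecs Y\<rbrakk> \<Longrightarrow> U (t a y) = t (restrict_seq {n} a) y"
    and z: "z \<in> vecs Z"
  shows "\<exists>y\<in>vecs Y. U z = L_op t n y"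
  using tc z
proof (induction rule: tensor_completion_induct)
  case (tensor a y)
  then show ?case
    by (intro bexI[of _ "smul Y (a n) y"])
      (simp_all add: Ut tensor_restrict_singleton[OF tc] smul_vecs[OF Y] del: lp_space_simps)
next
  note Z = tensor_banach_space[OF tc]
  case zero
  show ?case
    by (intro bexI[of _ 0] zero_vecs[OF Y])
      (simp add: linear_op_zero[OF Z bounded_op_linear[OF U(1)]]
        linear_op_zero[OF Y bounded_op_linear[OF bounded_op_L[OF tc]]])
next
  case (add u v)
  then obtain x y where "x \<in> vecs Y" "y \<in> vecs Y" "U u = L_op t n x" "U v = L_op t n y" by blast
  then show ?case
    using bounded_op_add[OF U(1) add(1,2)] bounded_op_add[OF bounded_op_L[OF tc], of x y]
    by (intro bexI[of _ "x + y"] add_vecs[OF Y]) auto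
next
  note Z = tensor_banach_space[OF tc]
  let ?L = "L_op t n"
  note L = bounded_op_L[OF tc, of n]
  case (limit z)
  \<comment> \<open>An approximating sequence with an explicit rate, so that the Cauchy property can be read off.\<close>
  have "\<exists>w y. w \<in> vecs Z \<and> y \<in> vecs Y \<and> U w = ?L y \<and> nrm Z (z - w) < inverse (Suc k)" for k
    using limit(2)[of "inverse (Suc k)"] by auto
  then obtain w y where w: "\<And>k. w k \<in> vecs Z" and y: "\<And>k. y k \<in> vecs Y"
    and wy: "\<And>k. U (w k) = ?L (y k)" and d: "\<And>k. nrm Z (z - w k) < inverse (Suc k)"
    by metis
  note Lv = bounded_op_vecs[OF L y] and Uz = bounded_op_vecs[OF U(1) limit(1)]
  have dU: "nrm Z (U z - ?L (y k)) < inverse (Suc k)" for k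
    using linear_op_diff[OF Z bounded_op_linear[OF U(1)] limit(1) w, of k]
      U(2)[OF minus_vecs[OF Z limit(1) w], of k] d[of k] by (simp add: wy)
  have nL: "nrm Z (?L u - ?L v) = nrm Y (u - v)" if "u \<in> vecs Y" "v \<in> vecs Y" for u v
    using nrm_L_op[OF tc minus_vecs[OF Y that], of n] linear_op_diff[OF Y bounded_op_linear[OF L] that]
    by simp
  have "\<exists>l\<in>vecs Y. (\<lambda>k. nrm Y (y k - l)) \<longlonglongrightarrow> 0"
  proof (rule banach_space_complete[OF Y y])
    fix e :: real assume "e > 0"
    then obtain M where M: "inverse (real (Suc M)) < e / 2" using reals_Archimedean[of "e/2"] by auto
    have small: "nrm Z (U z - ?L (y k)) < e / 2" if "k \<ge> M" for k
    proof -
      have "inverse (real (Suc k)) \<le> inverse (real (Suc M))" using that by simp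
      then show ?thesis using dU[of k] M by linarith
    qed
    have "nrm Y (y m - y k) < e" if "m \<ge> M" "k \<ge> M" for m k
      using nrm_triangle_diff[OF Z Lv Uz Lv, of m k] nrm_commute[OF Z Lv Uz, of m]
        small[OF that(1)] small[OF that(2)] nL[OF y y, of m k] by linarith
    then show "\<exists>M. \<forall>m\<ge>M. \<forall>k\<ge>M. nrm Y (y m - y k) < e" by blast
  qed
  then obtain l where l: "l \<in> vecs Y" and lim: "(\<lambda>k. nrm Y (y k - l)) \<longlonglongrightarrow> 0" by blast
  note Ll = bounded_op_vecs[OF L l]
  have "(\<lambda>k. inverse (real (Suc k)) + nrm Y (y k - l)) \<longlonglongrightarrow> 0 + 0"
    by (intro tendsto_add lim LIMSEQ_inverse_real_of_nat)
  moreover have "\<exists>M. \<forall>k\<ge>M. nrm Z (U z - ?L l) \<le> inverse (real (Suc k)) + nrm Y (y k - l)"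
  proof (intro exI allI impI)
    fix k
    show "nrm Z (U z - ?L l) \<le> inverse (real (Suc k)) + nrm Y (y k - l)"
      using nrm_triangle_diff[OF Z Uz Lv Ll, of k] dU[of k] nL[OF y l, of k] by linarith
  qed
  ultimately have "nrm Z (U z - ?L l) \<le> 0 + 0" by (rule LIMSEQ_le_const)
  then have "U z = ?L l" by (intro eq_if_nrm_arbitrarily_small[OF Z Uz Ll]) simp
  with l show ?case by blast
qed

text \<open>The coordinate map is the contraction onto the \<open>n\<close>-th copy of \<open>Y\<close>, followed by the inverse of the
isometry \<open>L n\<close>. Linearity and boundedness transfer from the contraction because \<open>L n\<close> is injective and
isometric.\<close>

lemma coordinate_op_exists:
  assumes p: "1 \<le> p" and Y: "banach_space Y" and tc: "tensor_completion p Y Z t"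
  shows "\<exists>G. bounded_op Z Y G \<and>
    (\<forall>a\<in>vecs (lp_space p). \<forall>y\<in>vecs Y. G (t a y) = smul Y (a n) y)"
proof -
  note Z = tensor_banach_space[OF tc]
  obtain U where U: "bounded_op Z Z U"
    "\<And>a y. \<lbrakk>a \<in> vecs (lp_space p); y \<in> vecs Y\<rbrakk> \<Longrightarrow> U (t a y) = t (restrict_seq {n} a) y"
    "\<And>z. z \<in> vecs Z \<Longrightarrow> nrm Z (U z) \<le> nrm Z z"
    using restriction_tensor_id[OF p Y tc, of "{n}"] by blast
  have "\<forall>z\<in>vecs Z. \<exists>y. y \<in> vecs Y \<and> U z = L_op t n y"
    using range_coordinate_op[OF Y tc U(1,3,2)] by blast
  then obtain G where G: "\<And>z. z \<in> vecs Z \<Longrightarrow> G z \<in> vecs Y"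
      "\<And>z. z \<in> vecs Z \<Longrightarrow> L_op t n (G z) = U z"
    by metis
  note L = bounded_op_L[OF tc, of n] and inj = L_op_inject[OF Y tc, of _ _ n]
  have "bounded_op Z Y G"
  proof (rule bounded_opI[where C=1])
    fix u v assume uv: "u \<in> vecs Z" "v \<in> vecs Z"
    show "G (u + v) = G u + G v"
      by (rule inj) (simp_all add: G uv add_vecs[OF Z] add_vecs[OF Y] bounded_op_add[OF L]
          bounded_op_add[OF U(1)])
  next
    fix c u assume u: "u \<in> vecs Z"
    show "G (smul Z c u) = smul Y c (G u)"
      by (rule inj) (simp_all add: G u smul_vecs[OF Z] smul_vecs[OF Y] bounded_op_smul[OF L]
          bounded_op_smul[OF U(1)])
  next
    fix u assume u: "u \<in> vecs Z"
    show "nrm Y (G u) \<le> 1 * nrm Z u"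
      using nrm_L_op[OF tc G(1)[OF u], of n] U(3)[OF u] by (simp add: G(2)[OF u])
  qed (rule G)
  moreover have "G (t a y) = smul Y (a n) y" if ay: "a \<in> vecs (lp_space p)" "y \<in> vecs Y" for a y
    by (rule inj) (use ay in \<open>simp_all add: G U(2) tensor_in_vecs[OF tc] smul_vecs[OF Y]
        tensor_restrict_singleton[OF tc] del: lp_space_simps\<close>)
  ultimately show ?thesis by blast
qed

lemma
  assumes "1 \<le> p" "banach_space Y" "tensor_completion p Y Z t"
  shows bounded_op_Gamma: "bounded_op Z Y (Gamma_op p Y Z t n)"
    and Gamma_op_tensor: "\<lbrakk>a \<in> vecs (lp_space p); y \<in> vecs Y\<rbrakk>
      \<Longrightarrow> Gamma_op p Y Z t n (t a y) = smul Y (a n) y"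
  using someI_ex[OF coordinate_op_exists[OF assms, of n], folded Gamma_op_def] by blast+

lemma Gamma_L_op:
  assumes "1 \<le> p" "banach_space Y" "tensor_completion p Y Z t" "y \<in> vecs Y"
  shows "Gamma_op p Y Z t n (L_op t m y) = (if m = n then y else 0)"
  unfolding L_op_def Gamma_op_tensor[OF assms(1-3) unit_seq_in_lp assms(4)]
  by (simp add: unit_seq_def smul_one[OF assms(2)] smul_zero_left[OF assms(2)])

text \<open>The partial sums agree with the contractions given by truncating sequences, first on elementary
tensors and then everywhere, so they are bounded by one uniformly. On an elementary tensor the error
is the tail of an \<open>\<ell>\<^sup>p\<close> sequence, and the uniform bound extends convergence to the completion.\<close>

lemma sums_in_L_Gamma:
  assumes p: "1 \<le> p" and Y: "banach_space Y" and tc: "tensor_completion p Y Z t"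
    and z: "z \<in> vecs Z"
  shows "sums_in Z (\<lambda>n. L_op t n (Gamma_op p Y Z t n z)) z"
proof -
  note Z = tensor_banach_space[OF tc]
  let ?l = "lp_space p" and ?G = "Gamma_op p Y Z t"
  note G = bounded_op_Gamma[OF p Y tc] and L = bounded_op_L[OF tc]
  define Q where "Q N z = (\<Sum>n<N. L_op t n (?G n z))" for N z
  have Qb: "bounded_op Z Z (Q N)" for N
  proof (induction N)
    case 0
    show ?case
      by (rule bounded_opI[where C=0])
        (simp_all add: Q_def zero_vecs[OF Z] smul_zero_right[OF Z] nrm_zero[OF Z])
  next
    case (Suc N)
    have "bounded_op Z Z (\<lambda>z. Q N z + L_op t N (?G N z))"
      by (intro bounded_op_plus[OF Z Z Suc] bounded_op_compose[OF Z Y G L])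
    then show ?case by (simp add: Q_def[abs_def])
  qed
  have Qt: "Q N (t a y) = t (restrict_seq {..<N} a) y" if a: "a \<in> vecs ?l" and y: "y \<in> vecs Y" for N a y
  proof (induction N)
    case 0
    \<comment> \<open>The empty restriction is written as a scalar multiple, so that homogeneity of the tensor map makes its tensor vanish.\<close>
    have "restrict_seq {..<0} a = smul ?l 0 (unit_seq 0)" by (auto simp: restrict_seq_def)
    then show ?case
      using linear_op_smul[OF linear_op_tensor_left[OF tc y] unit_seq_in_lp, of 0 0]
      by (simp add: Q_def smul_zero_left[OF Z])
  next
    case (Suc N)
    have "restrict_seq {..<Suc N} a = restrict_seq {..<N} a + restrict_seq {N} a"
      by (auto simp: restrict_seq_def fun_eq_iff)
    then have "t (restrict_seq {..<Suc N} a) y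
        = t (restrict_seq {..<N} a) y + t (restrict_seq {N} a) y"
      using linear_op_add[OF linear_op_tensor_left[OF tc y] restrict_seq_in_lp[OF p a]
          restrict_seq_in_lp[OF p a]] by simp
    then show ?case
      using Suc by (simp add: Q_def Gamma_op_tensor[OF p Y tc a y] tensor_restrict_singleton[OF tc a y])
  qed
  have Qle: "nrm Z (Q N z) \<le> nrm Z z" if z: "z \<in> vecs Z" for N z
  proof -
    obtain U where U: "bounded_op Z Z U"
      "\<And>a y. \<lbrakk>a \<in> vecs ?l; y \<in> vecs Y\<rbrakk> \<Longrightarrow> U (t a y) = t (restrict_seq {..<N} a) y"
      "\<And>z. z \<in> vecs Z \<Longrightarrow> nrm Z (U z) \<le> nrm Z z"
      using restriction_tensor_id[OF p Y tc, of "{..<N}"] by blast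
    have "Q N z = U z"
      by (rule bounded_op_eq_on_tensor[OF tc Z Qb U(1) _ z]) (simp only: Qt U(2))
    then show ?thesis using U(3)[OF z] by simp
  qed
  note Qv = bounded_op_vecs[OF Qb]
  have "(\<lambda>N. nrm Z (Q N z - z)) \<longlonglongrightarrow> 0"
    using tc z
  proof (induction rule: tensor_completion_induct)
    case (tensor a y)
    note ta = tensor_in_vecs[OF tc _ tensor(2)] and r = restrict_seq_in_lp[OF p tensor(1)]
    have eq: "nrm Z (Q N (t a y) - t a y) = nrm ?l (restrict_seq {N..} a) * nrm Y y" for N
    proof -
      have "a = restrict_seq {..<N} a + restrict_seq {N..} a"
        by (auto simp: restrict_seq_def fun_eq_iff)
      then have "t a y = Q N (t a y) + t (restrict_seq {N..} a) y"
        using linear_op_add[OF linear_op_tensor_left[OF tc tensor(2)] r r, of "{..<N}" "{N..}"]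
          Qt[OF tensor] by simp
      then have "t a y - Q N (t a y) = t (restrict_seq {N..} a) y" by (simp add: algebra_simps)
      then show ?thesis
        using nrm_commute[OF Z Qv[OF ta[OF tensor(1)]] ta[OF tensor(1)], of N]
          nrm_tensor[OF tc r tensor(2), of "{N..}"] by simp
    qed
    show ?case
      unfolding eq using tendsto_mult_right[OF nrm_lp_tail_tendsto_0[OF p tensor(1)], of "nrm Y y"]
      by simp
  next
    case zero
    show ?case
      by (simp add: linear_op_zero[OF Z bounded_op_linear[OF Qb]] nrm_zero[OF Z])
  next
    case (add u v)
    have d: "Q N u - u \<in> vecs Z" "Q N v - v \<in> vecs Z" for N
      by (intro minus_vecs[OF Z] Qv add)+
    have eq: "Q N (u + v) - (u + v) = (Q N u - u) + (Q N v - v)" for N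
      by (simp add: bounded_op_add[OF Qb add(1,2)])
    show ?case
    proof (rule tendsto_sandwich[where f="\<lambda>_. 0"])
      show "(\<lambda>N. nrm Z (Q N u - u) + nrm Z (Q N v - v)) \<longlonglongrightarrow> 0"
        using tendsto_add[OF add(3,4)] by simp
      show "\<forall>\<^sub>F N in sequentially. 0 \<le> nrm Z (Q N (u + v) - (u + v))"
        unfolding eq by (intro always_eventually allI nrm_nonneg Z add_vecs d)
      show "\<forall>\<^sub>F N in sequentially. nrm Z (Q N (u + v) - (u + v))
          \<le> nrm Z (Q N u - u) + nrm Z (Q N v - v)"
        unfolding eq by (intro always_eventually allI nrm_triangle Z d)
    qed simp
  next
    case (limit z)
    show ?case
    proof (rule LIMSEQ_I)
      fix e :: real assume "e > 0"
      then obtain w where w: "w \<in> vecs Z" "(\<lambda>N. nrm Z (Q N w - w)) \<longlonglongrightarrow> 0"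
          "nrm Z (z - w) < e / 3"
        using limit(2)[of "e / 3"] by auto
      obtain M where M: "\<And>N. N \<ge> M \<Longrightarrow> \<bar>nrm Z (Q N w - w)\<bar> < e / 3"
        using LIMSEQ_D[OF w(2), of "e / 3"] \<open>e > 0\<close> by auto
      have "norm (nrm Z (Q N z - z) - 0) < e" if N: "N \<ge> M" for N
      proof -
        note v = Qv[OF limit(1), of N] Qv[OF w(1), of N] w(1) limit(1)
        \<comment> \<open>The outer two of the three errors are at most the distance of \<open>z\<close> to \<open>w\<close>, by the uniform bound on the partial sums.\<close>
        have "nrm Z (Q N z - z) \<le> nrm Z (Q N z - Q N w) + nrm Z (Q N w - z)"
          by (rule nrm_triangle_diff[OF Z v(1,2,4)])
        moreover have "nrm Z (Q N w - z) \<le> nrm Z (Q N w - w) + nrm Z (w - z)"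
          by (rule nrm_triangle_diff[OF Z v(2,3,4)])
        moreover have "nrm Z (Q N z - Q N w) \<le> nrm Z (z - w)"
          using Qle[OF minus_vecs[OF Z v(4,3)], of N]
            linear_op_diff[OF Z bounded_op_linear[OF Qb] v(4,3), of N] by simp
        moreover have "nrm Z (w - z) = nrm Z (z - w)" by (rule nrm_commute[OF Z v(3,4)])
        moreover have "0 \<le> nrm Z (Q N z - z)" by (rule nrm_nonneg[OF Z minus_vecs[OF Z v(1,4)]])
        ultimately show ?thesis using M[OF N] w(3) by simp
      qed
      then show "\<exists>M. \<forall>N\<ge>M. norm (nrm Z (Q N z - z) - 0) < e" by blast
    qed
  qed
  then show ?thesis using z by (simp add: sums_in_def Q_def)
qed

section \<open>Frames\<close>

locale frame_setting =
  fixes p :: real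
    and Y :: "('k::{real_normed_field,banach}, 'y::ab_group_add) nspace"
    and Z :: "('k, 'z::ab_group_add) nspace"
    and t :: "(nat \<Rightarrow> 'k) \<Rightarrow> 'y \<Rightarrow> 'z"
  assumes p: "1 \<le> p" and Y: "banach_space Y" and tc: "tensor_completion p Y Z t"
begin

abbreviation "L \<equiv> L_op t"
abbreviation "\<Gamma> \<equiv> Gamma_op p Y Z t"

lemmas Z = tensor_banach_space[OF tc]
lemmas L_bounded = bounded_op_L[OF tc]
lemmas \<Gamma>_bounded = bounded_op_Gamma[OF p Y tc]

lemma
  fixes X :: "('k, 'x::ab_group_add) nspace"
  assumes X: "banach_space X" and asf: "op_ASF p Y Z t X A \<Psi>"
  shows op_ASF_analysis: "bounded_op X Z (analysis_op Z t A)"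
    and op_ASF_synthesis: "bounded_op Z X (synthesis_op p Y Z t X \<Psi>)"
    and sums_in_analysis: "x \<in> vecs X \<Longrightarrow> sums_in Z (\<lambda>n. L n (A n x)) (analysis_op Z t A x)"
    and sums_in_synthesis:
      "z \<in> vecs Z \<Longrightarrow> sums_in X (\<lambda>n. \<Psi> n (\<Gamma> n z)) (synthesis_op p Y Z t X \<Psi> z)"
    and op_ASF_bounded: "bounded_op X Y (A n)" "bounded_op Y X (\<Psi> n)"
    and op_ASF_frame: "invertible_op X (frame_op X A \<Psi>)"
proof -
  have A: "bounded_op X Y (A n)" and \<Psi>: "bounded_op Y X (\<Psi> n)" for n
    using asf by (auto simp: op_ASF_def)
  show "bounded_op X Y (A n)" "bounded_op Y X (\<Psi> n)" by (rule A, rule \<Psi>)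
  show "bounded_op X Z (analysis_op Z t A)" "bounded_op Z X (synthesis_op p Y Z t X \<Psi>)"
    "invertible_op X (frame_op X A \<Psi>)"
    using asf by (auto simp: op_ASF_def)
  show "sums_in Z (\<lambda>n. L n (A n x)) (analysis_op Z t A x)" if "x \<in> vecs X"
    unfolding analysis_op_def
    by (rule sums_in_the[OF Z])
      (use asf that in \<open>auto simp: op_ASF_def intro: bounded_op_vecs[OF L_bounded] bounded_op_vecs[OF A]\<close>)
  show "sums_in X (\<lambda>n. \<Psi> n (\<Gamma> n z)) (synthesis_op p Y Z t X \<Psi> z)" if "z \<in> vecs Z"
    unfolding synthesis_op_def
    by (rule sums_in_the[OF X])
      (use asf that in \<open>auto simp: op_ASF_def intro: bounded_op_vecs[OF \<Psi>] bounded_op_vecs[OF \<Gamma>_bounded]\<close>)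
qed

text \<open>By continuity \<open>\<Gamma> m\<close> acts on the series termwise, and it annihilates all terms but one.\<close>

lemma \<Gamma>_of_series:
  assumes y: "\<And>n. y n \<in> vecs Y" and z: "sums_in Z (\<lambda>n. L n (y n)) z"
  shows "\<Gamma> m z = y m"
proof (rule sums_in_unique[OF Y])
  show "sums_in Y (\<lambda>n. \<Gamma> m (L n (y n))) (\<Gamma> m z)"
    by (rule sums_in_bounded_op[OF Z Y \<Gamma>_bounded _ z]) (rule bounded_op_vecs[OF L_bounded y])
  have "\<Gamma> m (L n (y n)) = (if n = m then y m else 0)" for n
    by (simp add: Gamma_L_op[OF p Y tc y])
  then show "sums_in Y (\<lambda>n. \<Gamma> m (L n (y n))) (y m)"
    using sums_in_single[OF Y y, of m] by simp
  show "\<Gamma> m (L n (y n)) \<in> vecs Y" for n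
    by (intro bounded_op_vecs[OF \<Gamma>_bounded] bounded_op_vecs[OF L_bounded] y)
qed

text \<open>The frame operator is the analysis operator followed by the synthesis operator: the coefficients
\<open>A n x\<close> are recovered from the analysis of \<open>x\<close> by the coordinate maps. In particular, convergence
of the frame series is a consequence of convergence of the other two.\<close>

lemma synthesis_analysis:
  fixes X :: "('k, 'x::ab_group_add) nspace"
  assumes X: "banach_space X" and A: "\<And>n. bounded_op X Y (A n)" and \<Psi>: "\<And>n. bounded_op Y X (\<Psi> n)"
    and \<Theta>: "sums_in Z (\<lambda>n. L n (A n x)) z" and x: "x \<in> vecs X"
    and \<Xi>: "sums_in X (\<lambda>n. \<Psi> n (\<Gamma> n z)) s"
  shows "sums_in X (\<lambda>n. \<Psi> n (A n x)) s" "frame_op X A \<Psi> x = s"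
proof -
  have "\<Gamma> n z = A n x" for n
    by (rule \<Gamma>_of_series[OF _ \<Theta>]) (rule bounded_op_vecs[OF A x])
  with \<Xi> show s: "sums_in X (\<lambda>n. \<Psi> n (A n x)) s" by simp
  show "frame_op X A \<Psi> x = s"
    unfolding frame_op_def
    by (rule the_sums_in[OF X _ s]) (intro bounded_op_vecs[OF \<Psi>] bounded_op_vecs[OF A x])
qed

text \<open>A criterion that replaces the definite descriptions in the frame, analysis and synthesis operators by
explicit bounded operators \<open>\<Theta>\<close> and \<open>\<Xi>\<close> and an explicit inverse \<open>g\<close> of \<open>\<Xi> \<Theta>\<close>.\<close>

lemma op_ARB_I:
  fixes X :: "('k, 'x::ab_group_add) nspace"
  assumes X: "banach_space X"
    and A: "\<And>n. bounded_op X Y (A n)" and \<Psi>: "\<And>n. bounded_op Y X (\<Psi> n)"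
    and \<Theta>: "bounded_op X Z \<Theta>" "\<And>x. x \<in> vecs X \<Longrightarrow> sums_in Z (\<lambda>n. L n (A n x)) (\<Theta> x)"
    and \<Xi>: "bounded_op Z X \<Xi>" "\<And>z. z \<in> vecs Z \<Longrightarrow> sums_in X (\<lambda>n. \<Psi> n (\<Gamma> n z)) (\<Xi> z)"
    and g: "bounded_op X X g" "\<And>x. x \<in> vecs X \<Longrightarrow> g (\<Xi> (\<Theta> x)) = x"
      "\<And>x. x \<in> vecs X \<Longrightarrow> \<Xi> (\<Theta> (g x)) = x"
    and id: "\<And>z. z \<in> vecs Z \<Longrightarrow> \<Theta> (g (\<Xi> z)) = z"
  shows "op_ARB p Y Z t X A \<Psi>"
proof -
  note \<Theta>v = bounded_op_vecs[OF \<Theta>(1)] and \<Xi>v = bounded_op_vecs[OF \<Xi>(1)]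
    and gv = bounded_op_vecs[OF g(1)]
  note frame = synthesis_analysis[OF X A \<Psi> \<Theta>(2) _ \<Xi>(2)]
  have S: "frame_op X A \<Psi> x = \<Xi> (\<Theta> x)" if "x \<in> vecs X" for x
    by (rule frame(2)) (use that \<Theta>v in auto)
  have an: "analysis_op Z t A x = \<Theta> x" if "x \<in> vecs X" for x
    unfolding analysis_op_def
    by (rule the_sums_in[OF Z _ \<Theta>(2)[OF that]])
      (intro bounded_op_vecs[OF L_bounded] bounded_op_vecs[OF A] that)
  have sy: "synthesis_op p Y Z t X \<Psi> z = \<Xi> z" if "z \<in> vecs Z" for z
    unfolding synthesis_op_def
    by (rule the_sums_in[OF X _ \<Xi>(2)[OF that]])
      (intro bounded_op_vecs[OF \<Psi>] bounded_op_vecs[OF \<Gamma>_bounded] that)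
  have Sb: "bounded_op X X (frame_op X A \<Psi>)"
    by (rule bounded_op_cong[OF bounded_op_compose[OF X Z \<Theta>(1) \<Xi>(1)] X S])
  have inv: "inv_into (vecs X) (frame_op X A \<Psi>) x = g x" if "x \<in> vecs X" for x
  proof (rule inv_into_f_eq)
    show "inj_on (frame_op X A \<Psi>) (vecs X)"
      by (rule inj_on_inverseI[where g=g]) (simp add: S g(2))
  qed (simp_all add: S gv g(3) that)
  have "invertible_op X (frame_op X A \<Psi>)"
    unfolding invertible_op_def using Sb g gv S by (auto intro!: exI[of _ g])
  moreover have "\<exists>s. sums_in X (\<lambda>n. \<Psi> n (A n x)) s" if "x \<in> vecs X" for x
    using frame(1)[OF that that \<Theta>v[OF that]] by blast
  ultimately have "op_ASF p Y Z t X A \<Psi>"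
    unfolding op_ASF_def
    using A \<Psi> \<Theta> \<Xi> bounded_op_cong[OF \<Theta>(1) X an] bounded_op_cong[OF \<Xi>(1) Z sy] by blast
  moreover have "P_op p Y Z t X A \<Psi> z = z" if "z \<in> vecs Z" for z
    using that by (simp add: P_op_def sy inv \<Xi>v an gv id)
  ultimately show ?thesis by (simp add: op_ARB_def)
qed

end

theorem theorem2p8:
  fixes p :: real
    and X :: "('k::{real_normed_field,banach}, 'x::ab_group_add) nspace"
    and Y :: "('k, 'y::ab_group_add) nspace"
    and Z :: "('k, 'z::ab_group_add) nspace"
    and t :: "(nat \<Rightarrow> 'k) \<Rightarrow> 'y \<Rightarrow> 'z"
    and A :: "nat \<Rightarrow> 'x \<Rightarrow> 'y"
    and \<Psi> :: "nat \<Rightarrow> 'y \<Rightarrow> 'x"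
  assumes "1 \<le> p"
    and "banach_space X"
    and "banach_space Y"
    and "tensor_completion p Y Z t"
    and "op_ASF p Y Z t X A \<Psi>"
  shows "\<exists>(X1 :: ('k, 'x \<times> 'z) nspace) J B \<Phi>.
           banach_space X1 \<and> isometric_embedding X X1 J \<and>
           (\<forall>n. bounded_op X1 Y (B n)) \<and> (\<forall>n. bounded_op Y X1 (\<Phi> n)) \<and>
           op_ARB p Y Z t X1 B \<Phi> \<and>
           (\<forall>n. \<forall>x\<in>vecs X. B n (J x) = A n x)"
proof -
  interpret frame_setting p Y Z t by unfold_locales (rule assms)+
  note X = assms(2) and asf = assms(5)
  let ?\<theta> = "analysis_op Z t A" and ?\<Xi> = "synthesis_op p Y Z t X \<Psi>" and ?S = "frame_op X A \<Psi>"
  note \<theta> = op_ASF_analysis[OF X asf] and \<Xi> = op_ASF_synthesis[OF X asf]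
    and A = op_ASF_bounded(1)[OF X asf] and \<Psi> = op_ASF_bounded(2)[OF X asf]
  have S_eq: "?\<Xi> (?\<theta> x) = ?S x" if x: "x \<in> vecs X" for x
    by (rule synthesis_analysis(2)[OF X A \<Psi> sums_in_analysis[OF X asf x] x
          sums_in_synthesis[OF X asf bounded_op_vecs[OF \<theta> x]], symmetric])
  obtain h where h: "bounded_op X X h" "\<And>x. x \<in> vecs X \<Longrightarrow> h (?S x) = x"
      "\<And>x. x \<in> vecs X \<Longrightarrow> ?S (h x) = x"
    using op_ASF_frame[OF X asf] by (auto simp: invertible_op_def)
  \<comment> \<open>The idempotent associated with the given pair; \<open>h\<close> is the inverse of its frame operator.\<close>
  define P where "P z = ?\<theta> (h (?\<Xi> z))" for z
  have P: "bounded_op Z Z P"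
    unfolding P_def[abs_def]
    by (rule bounded_op_compose[OF Z X bounded_op_compose[OF Z X \<Xi> h(1)] \<theta>])
  have P\<theta>: "P (?\<theta> x) = ?\<theta> x" if "x \<in> vecs X" for x
    by (simp add: P_def S_eq h(2) that)
  have \<Xi>P: "?\<Xi> (P z) = ?\<Xi> z" if z: "z \<in> vecs Z" for z
    using bounded_op_vecs[OF \<Xi> z] by (simp add: P_def S_eq h(3) bounded_op_vecs[OF h(1)])
  have PP: "P (P z) = P z" if z: "z \<in> vecs Z" for z
    using P\<theta>[of "h (?\<Xi> z)"] bounded_op_vecs[OF h(1) bounded_op_vecs[OF \<Xi> z]] by (simp add: P_def)
  define R where "R z = z - P z" for z
  have R: "bounded_op Z Z R"
    unfolding R_def[abs_def] by (rule bounded_op_minus[OF Z Z bounded_op_id P])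
  have PR: "P (R z) = 0" if z: "z \<in> vecs Z" for z
    using linear_op_diff[OF Z bounded_op_linear[OF P] z bounded_op_vecs[OF P z]] PP[OF z]
    by (simp add: R_def)
  \<comment> \<open>The complementary subspace that \<open>X\<close> lacks.\<close>
  define K where "K = kernel_space Z P"
  have K: "banach_space K" unfolding K_def by (rule banach_space_kernel[OF Z Z P])
  have inclK: "bounded_op K Z (\<lambda>z. z)" unfolding K_def by (rule bounded_op_kernel_inclusion)
  have RK: "bounded_op Z K R" unfolding K_def by (rule bounded_op_into_kernel[OF R]) (rule PR)
  have vK: "z \<in> vecs K \<longleftrightarrow> z \<in> vecs Z \<and> P z = 0" for z by (simp add: K_def)
  have \<Xi>K: "?\<Xi> z = 0" if "z \<in> vecs K" for z
    using \<Xi>P[of z] that linear_op_zero[OF Z bounded_op_linear[OF \<Xi>]] by (simp add: vK)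
  define X1 where "X1 = direct_sum X K"
  have X1: "banach_space X1" unfolding X1_def by (rule banach_space_direct_sum[OF X K])
  have vX1: "u \<in> vecs X1 \<longleftrightarrow> fst u \<in> vecs X \<and> snd u \<in> vecs K" for u
    by (cases u) (simp add: X1_def)
  have fs: "bounded_op X1 X fst" "bounded_op X1 K snd"
    unfolding X1_def by (rule bounded_op_fst[OF X K], rule bounded_op_snd[OF X K])
  have sZ: "bounded_op X1 Z snd" by (rule bounded_op_compose[OF X1 K fs(2) inclK])
  define J where "J x = (x, 0 :: 'z)" for x :: 'x
  define B where "B n u = A n (fst u) + \<Gamma> n (snd u)" for n u
  define \<Phi> where "\<Phi> n y = (\<Psi> n y, R (L n y))" for n y
  \<comment> \<open>The explicit forms of the new analysis and synthesis operators.\<close>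
  define \<Theta> where "\<Theta> u = ?\<theta> (fst u) + snd u" for u
  define \<Xi>1 where "\<Xi>1 z = (?\<Xi> z, R z)" for z
  \<comment> \<open>The inverse of the new frame operator, which is diagonal.\<close>
  define g where "g u = (h (fst u), snd u)" for u :: "'x \<times> 'z"
  have B: "bounded_op X1 Y (B n)" for n
    unfolding B_def[abs_def]
    by (intro bounded_op_plus[OF X1 Y] bounded_op_compose[OF X1 X fs(1) A]
        bounded_op_compose[OF X1 Z sZ \<Gamma>_bounded])
  have \<Phi>: "bounded_op Y X1 (\<Phi> n)" for n
    unfolding \<Phi>_def[abs_def] X1_def
    by (intro bounded_op_Pair[OF Y] \<Psi> bounded_op_compose[OF Y Z L_bounded RK])
  have \<Theta>: "bounded_op X1 Z \<Theta>"
    unfolding \<Theta>_def[abs_def]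
    by (intro bounded_op_plus[OF X1 Z] bounded_op_compose[OF X1 X fs(1) \<theta>] sZ)
  have \<Xi>1: "bounded_op Z X1 \<Xi>1"
    unfolding \<Xi>1_def[abs_def] X1_def by (intro bounded_op_Pair[OF Z] \<Xi> RK)
  have g: "bounded_op X1 X1 g"
    unfolding g_def[abs_def] using bounded_op_Pair[OF X1 bounded_op_compose[OF X1 X fs(1) h(1)] fs(2)]
    by (simp add: X1_def)
  have R0: "R (?\<theta> x) = 0" if "x \<in> vecs X" for x
    using P\<theta>[OF that] by (simp add: R_def)
  \<comment> \<open>The cross terms vanish: synthesis annihilates the kernel of \<open>P\<close>, and \<open>I - P\<close> annihilates analysis values.\<close>
  have frame: "\<Xi>1 (\<Theta> u) = (?S (fst u), snd u)" if "u \<in> vecs X1" for u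
  proof -
    have u: "fst u \<in> vecs X" "snd u \<in> vecs K" "snd u \<in> vecs Z" "P (snd u) = 0"
      using that by (auto simp: vX1 vK)
    note v = bounded_op_vecs[OF \<theta> u(1)] u(3)
    show ?thesis
      using u(4) by (simp add: \<Xi>1_def \<Theta>_def bounded_op_add[OF \<Xi> v] bounded_op_add[OF R v]
          S_eq[OF u(1)] \<Xi>K[OF u(2)] R0[OF u(1)] R_def[of "snd u"])
  qed
  have "op_ARB p Y Z t X1 B \<Phi>"
  proof (rule op_ARB_I[OF X1 B \<Phi> \<Theta> _ \<Xi>1 _ g])
    fix u assume "u \<in> vecs X1"
    then have u: "fst u \<in> vecs X" "snd u \<in> vecs Z" by (auto simp: vX1 vK)
    have "sums_in Z (\<lambda>n. L n (A n (fst u)) + L n (\<Gamma> n (snd u))) (\<Theta> u)"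
      unfolding \<Theta>_def
      by (intro sums_in_add[OF Z] sums_in_analysis[OF X asf u(1)] sums_in_L_Gamma[OF p Y tc u(2)]
          bounded_op_vecs[OF L_bounded] bounded_op_vecs[OF A u(1)] bounded_op_vecs[OF \<Gamma>_bounded u(2)])
    then show "sums_in Z (\<lambda>n. L n (B n u)) (\<Theta> u)"
      by (simp add: B_def bounded_op_add[OF L_bounded] bounded_op_vecs[OF A u(1)]
          bounded_op_vecs[OF \<Gamma>_bounded u(2)])
  next
    fix z assume z: "z \<in> vecs Z"
    have "sums_in K (\<lambda>n. R (L n (\<Gamma> n z))) (R z)"
      by (intro sums_in_bounded_op[OF Z K RK] sums_in_L_Gamma[OF p Y tc z]
          bounded_op_vecs[OF L_bounded] bounded_op_vecs[OF \<Gamma>_bounded z])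
    then show "sums_in X1 (\<lambda>n. \<Phi> n (\<Gamma> n z)) (\<Xi>1 z)"
      unfolding \<Phi>_def \<Xi>1_def X1_def
      by (intro sums_in_direct_sum sums_in_synthesis[OF X asf z])
  next
    fix u assume u: "u \<in> vecs X1"
    then show "g (\<Xi>1 (\<Theta> u)) = u" by (simp add: frame g_def h(2) vX1)
    show "\<Xi>1 (\<Theta> (g u)) = u"
      using frame[OF bounded_op_vecs[OF g u]] u by (simp add: g_def h(3) vX1)
  next
    fix z assume "z \<in> vecs Z"
    then show "\<Theta> (g (\<Xi>1 z)) = z" by (simp add: \<Theta>_def g_def \<Xi>1_def R_def P_def)
  qed
  moreover have "isometric_embedding X X1 J"
    by (auto simp: isometric_embedding_def linear_op_def J_def X1_def zero_vecs[OF K]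
        smul_zero_right[OF K] nrm_zero[OF K])
  moreover have "B n (J x) = A n x" for n x
    by (simp add: B_def J_def linear_op_zero[OF Z bounded_op_linear[OF \<Gamma>_bounded]])
  ultimately show ?thesis using X1 B \<Phi> by blast
qed

end
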